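(* For an integer $t\geqslant 4$ put $$\eta(t)=\begin{cases}\dfrac{6t^2-14t+12}{3t^2-4t+8}, & \text{if } t \text{ is even},\\[3mm] \dfrac{2t^2-4t+2}{t^2-t+2}, & \text{if } t \text{ is odd}.\end{cases}$$ Then for any fixed integer $t\geqslant 4$, $$p_c(n;K_{2,t})=\mathrm{O}\left(n^{-1/\eta(t)}\right)\quad\text{as } n\to\infty,$$ that is, there is a constant $c>0$ (depending on $t$) such that $p_c(n;K_{2,t})\leqslant c\,n^{-1/\eta(t)}$ for all sufficiently large $n$.
   Context: All graphs are finite, undirected, without loops or multiple edges. $K_{s,t}$ is the complete bipartite graph with part sizes $s$ and $t$. $H$-bootstrap process: for graphs $G$ and $H$, let $G_0=G$ and, for $i=1,2,\ldots$, let $G_i$ be the graph with vertex set $V(G)$ and edge set $E(G_{i-1})\cup E_i$, where $E_i$ is the set of all edges $e$ of the complement of $G_{i-1}$ such that adding $e$ (alone) to $G_{i-1}$ creates a new copy of $H$ (as a not necessarily induced subgraph; a new copy is one containing $e$). Let $\widehat{G}_H$ be the graph with vertex set $V(G)$ and edge set $\bigcup_{i\geqslant 0}E(G_i)$. The graph $G$ percolates in the $H$-bootstrap process if $\widehat{G}_H$ is a complete graph. $\mathbb{G}(n,p)$ is the Erdős–Rényi random graph on a fixed vertex set of size $n$, in which every two distinct vertices are adjacent independently with probability $p$. Define $$p_c(n;H)=\inf\left\{p\in[0,1] : \mathbb{P}\big(\mathbb{G}(n,p)\text{ percolates in the }H\text{-bootstrap process}\big)\geqslant \tfrac12\right\}.$$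 *)

theory Defs
  imports
    "HOL-Probability.Product_PMF"
    "HOL-Library.Landau_Symbols"
begin

(* A graph is a pair (V, E).  It is a finite simple graph when V is finite and E \<subseteq> all_edges V;
   this is so for all graphs built below from complete_bipartite and random_graph. *)
type_synonym 'a graph = "'a set \<times> 'a set set"

abbreviation verts :: "'a graph \<Rightarrow> 'a set" where
  "verts G \<equiv> fst G"

abbreviation edges :: "'a graph \<Rightarrow> 'a set set" where
  "edges G \<equiv> snd G"

definition all_edges :: "'a set \<Rightarrow> 'a set set" where
  "all_edges V = {e. e \<subseteq> V \<and> card e = 2}"

definition is_complete :: "'a graph \<Rightarrow> bool" where
  "is_complete G \<longleftrightarrow> edges G = all_edges (verts G)"

definition complete_bipartite :: "nat \<Rightarrow> nat \<Rightarrow> (nat + nat) graph" where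
  "complete_bipartite s t =
     (Inl ` {..<s} \<union> Inr ` {..<t}, {{Inl i, Inr j} | i j. i < s \<and> j < t})"

definition is_subgraph :: "'a graph \<Rightarrow> 'a graph \<Rightarrow> bool" where
  "is_subgraph C G \<longleftrightarrow> verts C \<subseteq> verts G \<and> edges C \<subseteq> edges G"

definition is_copy :: "'a graph \<Rightarrow> 'b graph \<Rightarrow> bool" where
  "is_copy C H \<longleftrightarrow>
     (\<exists>f. inj_on f (verts H) \<and> C = (f ` verts H, (\<lambda>e. f ` e) ` edges H))"

definition add_edge :: "'a set \<Rightarrow> 'a graph \<Rightarrow> 'a graph" where
  "add_edge e G = (verts G, insert e (edges G))"

definition creates_copy :: "'b graph \<Rightarrow> 'a graph \<Rightarrow> 'a set \<Rightarrow> bool" where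
  "creates_copy H G e \<longleftrightarrow>
     (\<exists>C. is_copy C H \<and> is_subgraph C (add_edge e G) \<and> e \<in> edges C)"

definition bootstrap_step :: "'b graph \<Rightarrow> 'a graph \<Rightarrow> 'a graph" where
  "bootstrap_step H G =
     (verts G, edges G \<union> {e \<in> all_edges (verts G) - edges G. creates_copy H G e})"

primrec bootstrap :: "'b graph \<Rightarrow> 'a graph \<Rightarrow> nat \<Rightarrow> 'a graph" where
  "bootstrap H G 0 = G"
| "bootstrap H G (Suc i) = bootstrap_step H (bootstrap H G i)"

definition final_graph :: "'b graph \<Rightarrow> 'a graph \<Rightarrow> 'a graph" where
  "final_graph H G = (verts G, \<Union>i. edges (bootstrap H G i))"

definition percolates :: "'b graph \<Rightarrow> 'a graph \<Rightarrow> bool" where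
  "percolates H G \<longleftrightarrow> is_complete (final_graph H G)"

definition random_graph :: "nat \<Rightarrow> real \<Rightarrow> nat graph pmf" where
  "random_graph n p =
     map_pmf (\<lambda>b. ({..<n}, {e \<in> all_edges {..<n}. b e}))
       (Pi_pmf (all_edges {..<n}) False (\<lambda>_. bernoulli_pmf p))"

definition critical_prob :: "nat \<Rightarrow> 'b graph \<Rightarrow> real" where
  "critical_prob n H =
     Inf {p \<in> {0..1}. measure_pmf.prob (random_graph n p) {G. percolates H G} \<ge> 1 / 2}"

definition eta :: "nat \<Rightarrow> real" where
  "eta t =
     (if even t
      then (6 * real t ^ 2 - 14 * real t + 12) / (3 * real t ^ 2 - 4 * real t + 8)
      else (2 * real t ^ 2 - 4 * real t + 2) / (real t ^ 2 - real t + 2))"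

end

(* If two vertices have t - 1 common neighbours, the process makes them twins.  Hence two disjoint
   vertex sets of size t that are completely joined make a connected graph with a triangle complete:
   the two twin classes absorb everything.  It therefore suffices that G(n,p) is connected, which
   follows from a union bound, and contains a fixed gadget whose closure contains K_{t,t}.  The gadget
   has k = (t + 1) div 2 core vertices, q = t - 1 - k extra core vertices and k + 1 rim vertices.  The
   cores become twins through t - 1 private links each; the rim vertices share the k cores and q links
   and become twins; the extra core vertices share the k + 1 rim vertices and q - 1 links with the
   core and join it.  Splitting the weight 1 / eta t of every edge between its endpoints so that no
   vertex receives more than 1 shows that no subgraph of the gadget has edge-vertex ratio above eta t,
   so the second moment method applies at p = c n^(-1 / eta t). *)
theory Submission
  imports Defs "HOL-Real_Asymp.Real_Asymp"
begin

section \<open>The closure of a graph under the process and its twins\<close>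

section \<open>Twins in the closure\<close>

lemma edges_bootstrap_mono: "i \<le> j \<Longrightarrow> edges (bootstrap H G i) \<subseteq> edges (bootstrap H G j)"
  by (induction rule: dec_induct) (auto simp: bootstrap_step_def)

lemma verts_bootstrap [simp]: "verts (bootstrap H G i) = verts G"
  by (induction i) (auto simp: bootstrap_step_def)

lemma edges_bootstrap_subset:
  "edges G \<subseteq> all_edges (verts G) \<Longrightarrow> edges (bootstrap H G i) \<subseteq> all_edges (verts G)"
  by (induction i) (auto simp: bootstrap_step_def)

text \<open>The edges of \<open>C\<close> other than \<open>e\<close> are finitely many and the
  stages increase, so a single stage contains them all, and the next stage contains
  \<open>e\<close>.\<close>

lemma edges_final_graph_closed:
  assumes "is_copy C H" "finite (edges H)" "verts C \<subseteq> verts G" "e \<in> edges C"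
    and "edges C \<subseteq> insert e (edges (final_graph H G))" "e \<in> all_edges (verts G)"
  shows "e \<in> edges (final_graph H G)"
proof -
  have "finite (edges C - {e})"
    using assms(1,2) by (auto simp: is_copy_def)
  moreover have "edges C - {e} \<subseteq> (\<Union>i. edges (bootstrap H G i))"
    using assms(5) by (auto simp: final_graph_def)
  ultimately have "\<exists>i. edges C - {e} \<subseteq> edges (bootstrap H G i)"
  proof (induction rule: finite_induct)
    case (insert x F)
    then obtain i j where "F \<subseteq> edges (bootstrap H G i)" "x \<in> edges (bootstrap H G j)"
      by auto
    then have "insert x F \<subseteq> edges (bootstrap H G (max i j))"
      using edges_bootstrap_mono[of i "max i j" H G] edges_bootstrap_mono[of j "max i j" H G] by auto
    then show ?case by blast
  qed auto
  then obtain i where "edges C - {e} \<subseteq> edges (bootstrap H G i)" by blast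
  then have "creates_copy H (bootstrap H G i) e"
    using assms(1,3,4) unfolding creates_copy_def is_subgraph_def add_edge_def
    by (intro exI[of _ C]) auto
  then have "e \<in> edges (bootstrap H G (Suc i))"
    using assms(6) by (auto simp: bootstrap_step_def)
  then show ?thesis unfolding final_graph_def snd_conv by blast
qed

text \<open>Isolates the property of the closure that drives the combinatorial arguments, so that it
  can also be pulled back to the vertices of a gadget. In \<open>twin\<close>, \<open>u\<close> and
  \<open>w\<close> play the part of size 2, while \<open>v\<close> completes t - 1 vertices of
  \<open>S\<close> to the part of size t; if \<open>v\<close> lies in \<open>S\<close>, the
  conclusion is immediate.\<close>

locale twin_closed_graph =
  fixes t :: nat and V :: "'a set" and adj :: "'a \<Rightarrow> 'a \<Rightarrow> bool"
  assumes adj_sym: "adj u v \<Longrightarrow> adj v u"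
    and adj_irrefl: "\<not> adj u u"
    and adj_verts: "adj u v \<Longrightarrow> u \<in> V"
    and twin: "\<lbrakk>finite S; t \<le> card S + 1; \<And>x. x \<in> S \<Longrightarrow> adj u x \<and> adj w x;
                u \<noteq> w; adj w v; v \<noteq> u\<rbrakk> \<Longrightarrow> adj u v"
begin

text \<open>Vertices of \<open>X\<close> are twins of those of \<open>A\<close>, vertices of
  \<open>Y\<close> twins of those of \<open>B\<close>. Hence neighbours of one class lie in the
  other, connectivity gives \<open>X \<union> Y = V\<close>, and all pairs between \<open>X\<close>
  and \<open>Y\<close> are joined. The odd cycle then makes the two classes coincide.\<close>

lemma complete_if_contains_complete_bipartite:
  assumes t: "t \<ge> 2" and fin: "finite A" "finite B" and disj: "A \<inter> B = {}"
    and card: "card A \<ge> t" "card B \<ge> t"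
    and AB: "\<And>a b. a \<in> A \<Longrightarrow> b \<in> B \<Longrightarrow> adj a b"
    and conn: "\<And>S. S \<subseteq> V \<Longrightarrow> S \<noteq> {} \<Longrightarrow> S \<noteq> V \<Longrightarrow> \<exists>x\<in>S. \<exists>y\<in>V - S. adj x y"
    and tri: "adj x1 x2" "adj x2 x3" "adj x3 x1"
    and uv: "u \<in> V" "v \<in> V" "u \<noteq> v"
  shows "adj u v"
proof -
  \<comment> \<open>A vertex \<open>x\<close> may itself lie in \<open>B\<close>, hence the removal
    in \<open>B - {x}\<close>; the at least t - 1 vertices that remain are just what
    \<open>twin\<close> asks for.\<close>
  define X where "X = {x\<in>V. \<forall>b\<in>B - {x}. adj x b}"
  define Y where "Y = {y\<in>V. \<forall>a\<in>A - {y}. adj y a}"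
  have card': "t \<le> card (A - {z}) + 1" "t \<le> card (B - {z}) + 1" for z
    using card fin by (auto simp: card_Diff_singleton_if)
  have twinX: "adj x z \<longleftrightarrow> adj a z" if "x \<in> X" "a \<in> A" "z \<noteq> x" "z \<noteq> a" for x a z
  proof (cases "x = a")
    case False
    have *: "\<And>b. b \<in> B - {x} \<Longrightarrow> adj x b \<and> adj a b"
      using that AB by (auto simp: X_def)
    show ?thesis
      using twin[of "B - {x}" x a z] twin[of "B - {x}" a x z] * False that fin card' by auto
  qed auto
  have twinY: "adj y z \<longleftrightarrow> adj b z" if "y \<in> Y" "b \<in> B" "z \<noteq> y" "z \<noteq> b" for y b z
  proof (cases "y = b")
    case False
    have *: "\<And>a. a \<in> A - {y} \<Longrightarrow> adj y a \<and> adj b a"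
      using that AB adj_sym by (auto simp: Y_def)
    show ?thesis
      using twin[of "A - {y}" y b z] twin[of "A - {y}" b y z] * False that fin card' by auto
  qed auto
  have XY: "z \<in> Y" if "x \<in> X" "adj x z" for x z
  proof -
    have "adj z a" if "a \<in> A - {z}" for a
      using twinX[OF \<open>x \<in> X\<close>, of a z] that \<open>adj x z\<close> adj_sym adj_irrefl by blast
    moreover have "z \<in> V" using \<open>adj x z\<close> adj_sym adj_verts by blast
    ultimately show ?thesis by (simp add: Y_def)
  qed
  have YX: "z \<in> X" if "x \<in> Y" "adj x z" for x z
  proof -
    have "adj z a" if "a \<in> B - {z}" for a
      using twinY[OF \<open>x \<in> Y\<close>, of a z] that \<open>adj x z\<close> adj_sym adj_irrefl by blast
    moreover have "z \<in> V" using \<open>adj x z\<close> adj_sym adj_verts by blast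
    ultimately show ?thesis by (simp add: X_def)
  qed
  obtain a b where ab: "a \<in> A" "b \<in> B"
  proof -
    have "A \<noteq> {}" "B \<noteq> {}" using t card by auto
    then show ?thesis using that by blast
  qed
  have "a \<in> X" using ab AB adj_verts by (auto simp: X_def)
  have cover: "X \<union> Y = V"
  proof (rule ccontr)
    assume "X \<union> Y \<noteq> V"
    moreover have "X \<union> Y \<subseteq> V" by (auto simp: X_def Y_def)
    ultimately obtain x y where "x \<in> X \<union> Y" "y \<in> V - (X \<union> Y)" "adj x y"
      using conn[of "X \<union> Y"] \<open>a \<in> X\<close> by blast
    then show False using XY YX by blast
  qed
  have adjXY: "adj x y" if "x \<in> X" "y \<in> Y" "x \<noteq> y" for x y
  proof -
    have "A - {y} \<noteq> {}"
    proof
      assume "A - {y} = {}"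
      then have "card (A - {y}) = 0" by (metis card.empty)
      then show False using card'(1)[of y] t by linarith
    qed
    then obtain a' where a': "a' \<in> A" "a' \<noteq> y" by blast
    then have "adj a' y" using that adj_sym by (auto simp: Y_def)
    then show ?thesis using twinX[OF that(1) a'(1), of y] that a' by auto
  qed
  \<comment> \<open>Adjacency swaps \<open>X\<close> and \<open>Y\<close>, so going once round the
    triangle carries \<open>x1\<close> from its class into the other one.\<close>
  obtain z where z: "z \<in> X" "z \<in> Y"
  proof -
    have "x1 \<in> X \<union> Y" using tri adj_verts cover by blast
    then show ?thesis
    proof
      assume "x1 \<in> X"
      with tri XY YX have "x1 \<in> Y" by blast
      with \<open>x1 \<in> X\<close> show ?thesis using that by blast
    next
      assume "x1 \<in> Y"
      with tri XY YX have "x1 \<in> X" by blast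
      with \<open>x1 \<in> Y\<close> show ?thesis using that by blast
    qed
  qed
  \<comment> \<open>Every other vertex is joined to \<open>z\<close>, and \<open>z\<close> lies in
    both classes, so that vertex does too.\<close>
  have "x \<in> X \<and> x \<in> Y" if "x \<in> V" for x
    using that z cover adjXY[of x z] adjXY[of z x] XY[of z x] YX[of z x] adj_sym by blast
  then show ?thesis using adjXY uv by blast
qed

end

text \<open>Take \<open>u\<close>, \<open>w\<close> as the part of size 2 and \<open>v\<close> with
  t - 1 elements of \<open>S\<close> as the other part: all edges of this copy except possibly
  \<open>{u, v}\<close> are present, so the closure contains that one as well.\<close>

lemma twin_closed_final_graph:
  fixes E :: "'a set set"
  assumes E: "E \<subseteq> all_edges V" and t: "t \<ge> 2"
  defines "F \<equiv> edges (final_graph (complete_bipartite 2 t) (V, E))"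
  shows "twin_closed_graph t V (\<lambda>u v. {u, v} \<in> F)"
proof
  have F: "F \<subseteq> all_edges V"
    using edges_bootstrap_subset[of "(V, E)" "complete_bipartite 2 t"] E by (fastforce simp: F_def final_graph_def)
  show "{v, u} \<in> F" if "{u, v} \<in> F" for u v using that by (simp add: insert_commute)
  show irr: "{u, u} \<notin> F" for u using F by (auto simp: all_edges_def)
  show "u \<in> V" if "{u, v} \<in> F" for u v using F that by (auto simp: all_edges_def)
  show "{u, v} \<in> F"
    if fS: "finite S" and cS: "t \<le> card S + 1" and S: "\<And>x. x \<in> S \<Longrightarrow> {u, x} \<in> F \<and> {w, x} \<in> F"
      and uw: "u \<noteq> w" and wv: "{w, v} \<in> F" and vu: "v \<noteq> u" for S u w v
  proof (rule ccontr)
    assume nF: "{u, v} \<notin> F"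
    then have vS: "v \<notin> S" using S by auto
    obtain S' where S': "S' \<subseteq> S" "card S' = t - 1"
      using cS fS by (metis diff_le_mono diff_add_inverse2 obtain_subset_with_card_n)
    obtain s where s: "bij_betw s {..<t - 1} S'"
      using ex_bij_betw_nat_finite[of S'] S' fS by (metis atLeast0LessThan finite_subset)
    \<comment> \<open>Index t - 1 is reserved for \<open>v\<close>, so the missing edge is the image
      of \<open>{Inl 0, Inr (t - 1)}\<close>.\<close>
    define s' where "s' j = (if j = t - 1 then v else s j)" for j
    have s'S: "s' j \<in> S'" if "j < t - 1" for j
      using s that by (auto simp: s'_def bij_betw_def)
    have inj_s': "inj_on s' {..<t}"
    proof (rule inj_onI)
      fix i j assume ij: "i \<in> {..<t}" "j \<in> {..<t}" "s' i = s' j"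
      consider "i < t - 1" "j < t - 1" | "i = t - 1" "j = t - 1" | "i = t - 1" "j < t - 1"
        | "i < t - 1" "j = t - 1" using ij by force
      then show "i = j"
      proof cases
        case 1 then show ?thesis using ij s by (auto simp: s'_def bij_betw_def inj_on_def)
      next
        case 3 then show ?thesis using s'S[of j] ij vS S' by (auto simp: s'_def split: if_splits)
      next
        case 4 then show ?thesis using s'S[of i] ij vS S' by (auto simp: s'_def split: if_splits)
      qed auto
    qed
    have s'_cases: "s' j = v \<or> s' j \<in> S" if "j < t" for j
    proof (cases "j = t - 1")
      case False
      then have "s' j \<in> S'" using s'S that by simp
      then show ?thesis using S' by blast
    qed (simp add: s'_def)
    \<comment> \<open>Apart from \<open>v = u\<close>, which is excluded, any coincidence would give
      a loop in \<open>F\<close>.\<close>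
    have nuw: "s' j \<noteq> u" "s' j \<noteq> w" if "j < t" for j
      using s'_cases[OF that] vu S[of u] S[of w] wv irr by auto
    define f where "f z = (case z of Inl i \<Rightarrow> (if i = 0 then u else w) | Inr j \<Rightarrow> s' j)"
      for z :: "nat + nat"
    let ?H = "complete_bipartite 2 t"
    define C where "C = (f ` verts ?H, (\<lambda>e. f ` e) ` edges ?H)"
    have injf: "inj_on f (verts ?H)"
    proof (rule inj_onI)
      fix x y assume xy: "x \<in> verts ?H" "y \<in> verts ?H" "f x = f y"
      show "x = y"
      proof (cases x; cases y)
        fix i j assume "x = Inl i" "y = Inl j"
        then show ?thesis using xy uw
          by (auto simp: complete_bipartite_def f_def less_2_cases_iff split: if_splits)
      next
        fix i j assume "x = Inl i" "y = Inr j"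
        then show ?thesis using xy nuw[of j]
          by (auto simp: complete_bipartite_def f_def split: if_splits)
      next
        fix i j assume "x = Inr i" "y = Inl j"
        then show ?thesis using xy nuw[of i]
          by (auto simp: complete_bipartite_def f_def split: if_splits)
      next
        fix i j assume "x = Inr i" "y = Inr j"
        then show ?thesis using xy inj_s'
          by (auto simp: complete_bipartite_def f_def inj_on_def)
      qed
    qed
    have copy: "is_copy C ?H" using injf unfolding is_copy_def C_def by blast
    have fin: "finite (edges ?H)"
    proof -
      have "edges ?H = (\<lambda>(i, j). {Inl i, Inr j}) ` ({..<2} \<times> {..<t})"
        by (auto simp: complete_bipartite_def)
      then show ?thesis by simp
    qed
    have sF: "{w, s' j} \<in> F \<and> (s' j = v \<or> {u, s' j} \<in> F)" if "j < t" for j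
      using s'_cases[OF that] S wv by auto
    have inV: "u \<in> V" "w \<in> V" "v \<in> V" and sV: "\<And>j. j < t \<Longrightarrow> s' j \<in> V"
    proof -
      show "w \<in> V" "v \<in> V" using wv F by (auto simp: all_edges_def)
      show sV: "s' j \<in> V" if "j < t" for j using sF[OF that] F by (auto simp: all_edges_def)
      have "S \<noteq> {}" using cS t by auto
      then show "u \<in> V" using S F by (auto simp: all_edges_def)
    qed
    have eC: "edges C \<subseteq> insert {u, v} F"
    proof
      fix e assume "e \<in> edges C"
      then obtain i j where "e = {f (Inl i), f (Inr j)}" "j < t"
        by (auto simp: C_def complete_bipartite_def)
      then show "e \<in> insert {u, v} F" using sF[of j] by (auto simp: f_def)
    qed
    have "{u, v} \<in> edges C"
    proof -
      have "{Inl 0, Inr (t - 1)} \<in> edges ?H" unfolding complete_bipartite_def snd_conv mem_Collect_eq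
        using t by (intro exI[of _ 0] exI[of _ "t - 1"]) simp
      then have "f ` {Inl 0, Inr (t - 1)} \<in> edges C" unfolding C_def snd_conv by (rule imageI)
      then show ?thesis by (simp add: f_def s'_def)
    qed
    moreover have "verts C \<subseteq> V"
    proof
      fix x assume "x \<in> verts C"
      then obtain z where z: "z \<in> verts ?H" "x = f z" by (auto simp: C_def)
      show "x \<in> V"
        using z inV sV by (cases z) (auto simp: complete_bipartite_def f_def)
    qed
    moreover have "{u, v} \<in> all_edges V" using inV vu by (auto simp: all_edges_def)
    ultimately have "{u, v} \<in> F"
      unfolding F_def using eC[unfolded F_def]
      by (intro edges_final_graph_closed[OF copy fin]) (simp_all del: insert_subset)
    with nF show False by blast
  qed
qed

section \<open>Second moments for embedded copies in the random graph\<close>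

section \<open>The second moment method\<close>

abbreviation bernoulli_edges :: "'a set \<Rightarrow> real \<Rightarrow> ('a \<Rightarrow> bool) pmf" where
  "bernoulli_edges A p \<equiv> Pi_pmf A False (\<lambda>_. bernoulli_pmf p)"

lemma prob_all_present:
  assumes "finite A" "T \<subseteq> A" "0 \<le> p" "p \<le> 1"
  shows "measure_pmf.prob (bernoulli_edges A p) {b. \<forall>e\<in>T. b e} = p ^ card T"
proof -
  have "{b. \<forall>e\<in>T. b e} = Pi A (\<lambda>e. if e \<in> T then {True} else UNIV)"
    using assms(2) by (auto simp: Pi_def split: if_splits)
  then have "measure_pmf.prob (bernoulli_edges A p) {b. \<forall>e\<in>T. b e}
      = (\<Prod>e\<in>A. if e \<in> T then p else 1)"
    using assms by (simp add: measure_Pi_pmf_Pi if_distrib measure_pmf_single cong: if_cong)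
  also have "\<dots> = p ^ card T"
    using assms by (simp add: prod.If_cases Int_absorb1)
  finally show ?thesis .
qed

lemma prob_none_present:
  assumes "finite A" "T \<subseteq> A" "0 \<le> p" "p \<le> 1"
  shows "measure_pmf.prob (bernoulli_edges A p) {b. \<forall>e\<in>T. \<not> b e} = (1 - p) ^ card T"
proof -
  have "{b. \<forall>e\<in>T. \<not> b e} = Pi A (\<lambda>e. if e \<in> T then {False} else UNIV)"
    using assms(2) by (auto simp: Pi_def split: if_splits)
  then have "measure_pmf.prob (bernoulli_edges A p) {b. \<forall>e\<in>T. \<not> b e}
      = (\<Prod>e\<in>A. if e \<in> T then 1 - p else 1)"
    using assms by (simp add: measure_Pi_pmf_Pi if_distrib measure_pmf_single cong: if_cong)
  also have "\<dots> = (1 - p) ^ card T"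
    using assms by (simp add: prod.If_cases Int_absorb1)
  finally show ?thesis .
qed

lemma finite_set_bernoulli_edges: "finite A \<Longrightarrow> finite (set_pmf (bernoulli_edges A p))"
  by (subst set_Pi_pmf) (auto intro!: finite_PiE_dflt simp del: set_pmf_bernoulli)

text \<open>Chebyshev's inequality for the number \<open>X\<close> of indices whose edge set is
  fully present, counted with multiplicity if sets coincide. The correlation bound makes the
  variance at most \<epsilon> times the squared mean, and \<open>X = 0\<close> is a deviation by the
  whole mean.\<close>

lemma second_moment_bound:
  fixes T :: "'i \<Rightarrow> 'a set" and \<epsilon> :: real
  assumes fin: "finite A" "finite \<Phi>" "\<Phi> \<noteq> {}"
    and T: "\<And>\<phi>. \<phi> \<in> \<Phi> \<Longrightarrow> T \<phi> \<subseteq> A" "\<And>\<phi>. \<phi> \<in> \<Phi> \<Longrightarrow> card (T \<phi>) = m"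
    and p: "0 < p" "p \<le> 1"
    and corr: "\<And>\<phi>. \<phi> \<in> \<Phi> \<Longrightarrow> (\<Sum>\<psi>\<in>\<Phi>. (1 / p) ^ card (T \<phi> \<inter> T \<psi>)) \<le> (1 + \<epsilon>) * card \<Phi>"
  shows "measure_pmf.prob (bernoulli_edges A p) {b. \<forall>\<phi>\<in>\<Phi>. \<exists>e\<in>T \<phi>. \<not> b e} \<le> \<epsilon>"
proof -
  let ?M = "bernoulli_edges A p"
  let ?P = "measure_pmf.prob ?M"
  define B where "B \<phi> = {b. \<forall>e\<in>T \<phi>. b e}" for \<phi>
  define X where "X b = (\<Sum>\<phi>\<in>\<Phi>. indicator (B \<phi>) b :: real)" for b
  define \<mu> where "\<mu> = real (card \<Phi>) * p ^ m"
  have \<mu>: "\<mu> > 0" using fin p by (simp add: \<mu>_def card_gt_0_iff)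
  have int: "integrable ?M f" for f :: "_ \<Rightarrow> real"
    using fin finite_set_bernoulli_edges by (intro integrable_measure_pmf_finite)
  have PB: "?P (B \<phi>) = p ^ m" if "\<phi> \<in> \<Phi>" for \<phi>
    using prob_all_present[of A "T \<phi>" p] T that fin p by (simp add: B_def)
  have EX: "measure_pmf.expectation ?M X = \<mu>"
    unfolding X_def using int PB by (simp add: Bochner_Integration.integral_sum \<mu>_def)
  have PBB: "?P (B \<phi> \<inter> B \<psi>) = p ^ (2 * m) * (1 / p) ^ card (T \<phi> \<inter> T \<psi>)"
    if "\<phi> \<in> \<Phi>" "\<psi> \<in> \<Phi>" for \<phi> \<psi>
  proof -
    have finT: "finite (T \<phi>)" "finite (T \<psi>)"
      using T that fin finite_subset by blast+
    have "B \<phi> \<inter> B \<psi> = {b. \<forall>e\<in>T \<phi> \<union> T \<psi>. b e}" by (auto simp: B_def)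
    then have "?P (B \<phi> \<inter> B \<psi>) = p ^ card (T \<phi> \<union> T \<psi>)"
      using prob_all_present[of A "T \<phi> \<union> T \<psi>" p] T that fin p by simp
    \<comment> \<open>Common edges count once in the union, so the exponent drops from 2 m by the
      size of the overlap; this produces the factor \<open>1 / p\<close> per common edge.\<close>
    moreover have "2 * m = card (T \<phi> \<union> T \<psi>) + card (T \<phi> \<inter> T \<psi>)"
      using card_Un_Int[OF finT] T that by simp
    ultimately show ?thesis using p by (simp add: power_add field_simps power_one_over)
  qed
  have "measure_pmf.expectation ?M (\<lambda>b. (X b)\<^sup>2)
      = (\<Sum>\<phi>\<in>\<Phi>. \<Sum>\<psi>\<in>\<Phi>. measure_pmf.expectation ?M (\<lambda>b. indicator (B \<phi> \<inter> B \<psi>) b))"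
    unfolding X_def power2_eq_square sum_product indicator_inter_arith
    using int by (simp add: Bochner_Integration.integral_sum)
  also have "\<dots> = (\<Sum>\<phi>\<in>\<Phi>. \<Sum>\<psi>\<in>\<Phi>. p ^ (2 * m) * (1 / p) ^ card (T \<phi> \<inter> T \<psi>))"
    using PBB by (intro sum.cong refl) simp
  also have "\<dots> = (\<Sum>\<phi>\<in>\<Phi>. p ^ (2 * m) * (\<Sum>\<psi>\<in>\<Phi>. (1 / p) ^ card (T \<phi> \<inter> T \<psi>)))"
    by (simp add: sum_distrib_left)
  also have "\<dots> \<le> (\<Sum>\<phi>\<in>\<Phi>. p ^ (2 * m) * ((1 + \<epsilon>) * card \<Phi>))"
    using corr p by (intro sum_mono mult_left_mono) auto
  also have "\<dots> = (1 + \<epsilon>) * \<mu>\<^sup>2"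
    by (simp add: \<mu>_def power2_eq_square power_mult mult_2 power_add)
  finally have EX2: "measure_pmf.expectation ?M (\<lambda>b. (X b)\<^sup>2) \<le> (1 + \<epsilon>) * \<mu>\<^sup>2" .
  have "{b. \<forall>\<phi>\<in>\<Phi>. \<exists>e\<in>T \<phi>. \<not> b e} \<subseteq> {b. \<bar>X b - measure_pmf.expectation ?M X\<bar> \<ge> \<mu>}"
  proof clarify
    fix b assume "\<forall>\<phi>\<in>\<Phi>. \<exists>e\<in>T \<phi>. \<not> b e"
    then have "X b = 0" unfolding X_def by (intro sum.neutral) (auto simp: B_def)
    then show "\<mu> \<le> \<bar>X b - measure_pmf.expectation ?M X\<bar>" using \<mu> by (simp add: EX)
  qed
  then have "?P {b. \<forall>\<phi>\<in>\<Phi>. \<exists>e\<in>T \<phi>. \<not> b e} \<le> ?P {b. \<bar>X b - measure_pmf.expectation ?M X\<bar> \<ge> \<mu>}"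
    by (intro measure_pmf.finite_measure_mono) auto
  also have "\<dots> \<le> measure_pmf.variance ?M X / \<mu>\<^sup>2"
    using measure_pmf.Chebyshev_inequality[of X ?M \<mu>] int \<mu> by simp
  also have "measure_pmf.variance ?M X \<le> \<epsilon> * \<mu>\<^sup>2"
    using EX2 by (subst measure_pmf.variance_eq) (auto simp: int EX algebra_simps)
  finally show ?thesis using \<mu> by (simp add: divide_right_mono)
qed

text \<open>Every factor \<open>n - i\<close> of the falling factorial is at least n / 2.\<close>

lemma card_injective_maps_lower_bound:
  assumes "finite W" "n \<ge> 2 * card W"
  shows "real n ^ card W \<le> 2 ^ card W * card {\<phi> \<in> W \<rightarrow>\<^sub>E {..<n}. inj_on \<phi> W}"
proof -
  let ?v = "card W"
  have "card {\<phi> \<in> W \<rightarrow>\<^sub>E {..<n}. inj_on \<phi> W} = (\<Prod>i = 0..<?v. n - i)"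
    using card_inj_on_subset_funcset[of W "{..<n}" W] assms by simp
  moreover have "real n ^ ?v / 2 ^ ?v \<le> (\<Prod>i = 0..<?v. real (n - i))"
  proof -
    have "(\<Prod>i = 0..<?v. real n / 2) \<le> (\<Prod>i = 0..<?v. real (n - i))"
      using assms by (intro prod_mono) auto
    then show ?thesis by (simp add: power_divide)
  qed
  ultimately show ?thesis by (simp add: field_simps)
qed

text \<open>Choose for each \<open>x\<close> in \<open>U\<close> a preimage \<open>\<iota> x\<close>
  of \<open>\<phi> x\<close> under \<open>\<psi>\<close>. As \<open>\<phi>\<close> is injective on
  \<open>U\<close>, so is \<open>\<iota>\<close>; hence \<open>\<psi>\<close> is prescribed at
  exactly \<open>card U\<close> vertices and free at the others.\<close>

lemma card_maps_covering:
  assumes fin: "finite W" and U: "U \<subseteq> W" and inj: "inj_on \<phi> U"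
  shows "card {\<psi> \<in> W \<rightarrow>\<^sub>E {..<n}. \<phi> ` U \<subseteq> \<psi> ` W} \<le> card W ^ card W * n ^ (card W - card U)"
proof -
  define I where "I = {\<iota> \<in> U \<rightarrow>\<^sub>E W. inj_on \<iota> U}"
  define S where "S \<iota> = {\<psi> \<in> W \<rightarrow>\<^sub>E {..<n}. \<forall>x\<in>U. \<psi> (\<iota> x) = \<phi> x}" for \<iota>
  have finU: "finite U" using fin U finite_subset by blast
  have finI: "finite I" unfolding I_def
    using fin finU by (intro finite_subset[OF _ finite_PiE[of U "\<lambda>_. W"]]) auto
  have cI: "card I \<le> card W ^ card W"
  \<comment> \<open>Raising the exponent to \<open>card W\<close> needs
    \<open>card W \<ge> 1\<close>, which a nonempty \<open>U\<close> guarantees; if \<open>W\<close>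
    is empty, 0 ^ 0 = 1 serves.\<close>
  proof (cases "U = {}")
    case True
    have "card I \<le> card (U \<rightarrow>\<^sub>E W)" unfolding I_def
      using fin finU by (intro card_mono finite_PiE) auto
    also have "\<dots> = 1" using True by simp
    also have "\<dots> \<le> card W ^ card W" by (cases "card W") (auto simp: Suc_le_eq)
    finally show ?thesis .
  next
    case False
    have "card I \<le> card (U \<rightarrow>\<^sub>E W)" unfolding I_def
      using fin finU by (intro card_mono finite_PiE) auto
    also have "\<dots> = card W ^ card U" using finU by (simp add: card_funcsetE)
    also have "\<dots> \<le> card W ^ card W"
      using False U fin by (intro power_increasing card_mono) (auto simp: Suc_le_eq card_gt_0_iff)
    finally show ?thesis .
  qed
  have cS: "card (S \<iota>) \<le> n ^ (card W - card U)" if "\<iota> \<in> I" for \<iota>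
  proof -
    define g where "g = inv_into U \<iota>"
    have \<iota>: "inj_on \<iota> U" "\<iota> ` U \<subseteq> W" using that by (auto simp: I_def)
    have "S \<iota> \<subseteq> PiE W (\<lambda>w. if w \<in> \<iota> ` U then {\<phi> (g w)} else {..<n})"
      using \<iota> by (auto simp: S_def g_def PiE_def Pi_def extensional_def)
    then have "card (S \<iota>) \<le> card (PiE W (\<lambda>w. if w \<in> \<iota> ` U then {\<phi> (g w)} else {..<n}))"
      using fin by (intro card_mono finite_PiE) auto
    also have "\<dots> = (\<Prod>w\<in>W. if w \<in> \<iota> ` U then 1 else n)"
      using fin by (simp add: card_PiE if_distrib cong: if_cong)
    also have "\<dots> = n ^ card (W - \<iota> ` U)"
      using fin by (simp add: prod.If_cases Diff_eq)
    also have "card (W - \<iota> ` U) = card W - card U"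
      using \<iota> finU by (simp add: card_Diff_subset card_image)
    finally show ?thesis .
  qed
  have "{\<psi> \<in> W \<rightarrow>\<^sub>E {..<n}. \<phi> ` U \<subseteq> \<psi> ` W} \<subseteq> (\<Union>\<iota>\<in>I. S \<iota>)"
  proof
    fix \<psi> assume \<psi>: "\<psi> \<in> {\<psi> \<in> W \<rightarrow>\<^sub>E {..<n}. \<phi> ` U \<subseteq> \<psi> ` W}"
    define \<iota> where "\<iota> = restrict (\<lambda>x. inv_into W \<psi> (\<phi> x)) U"
    have *: "\<iota> x \<in> W" "\<psi> (\<iota> x) = \<phi> x" if "x \<in> U" for x
      using \<psi> that by (auto simp: \<iota>_def image_subset_iff inv_into_into f_inv_into_f)
    have "inj_on \<iota> U" using * inj by (metis inj_onD inj_onI)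
    then have "\<iota> \<in> I" using * by (auto simp: I_def \<iota>_def)
    moreover have "\<psi> \<in> S \<iota>" using \<psi> * by (auto simp: S_def)
    ultimately show "\<psi> \<in> (\<Union>\<iota>\<in>I. S \<iota>)" by blast
  qed
  moreover have "finite (\<Union>\<iota>\<in>I. S \<iota>)"
  proof -
    have "(\<Union>\<iota>\<in>I. S \<iota>) \<subseteq> W \<rightarrow>\<^sub>E {..<n}" by (auto simp: S_def)
    then show ?thesis using fin by (meson finite_PiE finite_lessThan finite_subset)
  qed
  ultimately have "card {\<psi> \<in> W \<rightarrow>\<^sub>E {..<n}. \<phi> ` U \<subseteq> \<psi> ` W} \<le> card (\<Union>\<iota>\<in>I. S \<iota>)"
    by (intro card_mono)
  also have "\<dots> \<le> (\<Sum>\<iota>\<in>I. card (S \<iota>))" using finI by (rule card_UN_le)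
  also have "\<dots> \<le> card I * n ^ (card W - card U)"
    using sum_bounded_above[of I "\<lambda>\<iota>. card (S \<iota>)"] cS by auto
  also have "\<dots> \<le> card W ^ card W * n ^ (card W - card U)"
    using cI by simp
  finally show ?thesis .
qed

text \<open>Sorts the embeddings \<open>\<psi>\<close> by the set \<open>Q\<close> of edges they
  share with a fixed \<open>\<phi>\<close>. A nonempty \<open>Q\<close> costs a factor of order n ^
  card (\<Union>Q) in the number of embeddings and gains (1 / p) ^ card Q, which by
  \<open>sparse\<close> is smaller by a factor of at least \<open>c\<close>. There are at most 2 ^
  card E sets \<open>Q\<close>.\<close>

lemma prob_no_copy_le:
  fixes W :: "'b set" and \<alpha> c p :: real
  assumes W: "finite W" and E: "E \<subseteq> all_edges W"
    and sparse: "\<And>J. J \<subseteq> E \<Longrightarrow> \<alpha> * card J \<le> card (\<Union>J)"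
    and n: "n \<ge> 2 * card W" "n > 0" and c: "c \<ge> 1"
    and p: "p = c * real n powr - \<alpha>" "p \<le> 1"
  shows "measure_pmf.prob (bernoulli_edges (all_edges {..<n}) p)
      {b. \<not> (\<exists>\<phi>. \<phi> \<in> W \<rightarrow> {..<n} \<and> inj_on \<phi> W \<and> (\<forall>e\<in>E. b (\<phi> ` e)))}
    \<le> 2 ^ card E * (2 * card W) ^ card W / c"
proof -
  define \<Phi> where "\<Phi> = {\<phi> \<in> W \<rightarrow>\<^sub>E {..<n}. inj_on \<phi> W}"
  define T where "T \<phi> = (\<lambda>e. \<phi> ` e) ` E" for \<phi> :: "'b \<Rightarrow> nat"
  define v where "v = card W"
  define K where "K = (2 ^ card E * (2 * card W) ^ card W :: real)"
  have p0: "p > 0" using p n c by simp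
  have finE: "finite E"
    by (rule finite_subset[OF E], rule finite_subset[of _ "Pow W"]) (use W in \<open>auto simp: all_edges_def\<close>)
  have finA: "finite (all_edges {..<n})"
    by (rule finite_subset[of _ "Pow {..<n}"]) (auto simp: all_edges_def)
  have fin\<Phi>: "finite \<Phi>" unfolding \<Phi>_def
    using W by (intro finite_subset[OF _ finite_PiE[of W "\<lambda>_. {..<n}"]]) auto
  have M: "real n ^ v \<le> 2 ^ v * card \<Phi>"
    using card_injective_maps_lower_bound[OF W n(1)] by (simp add: \<Phi>_def v_def)
  have "\<Phi> \<noteq> {}"
  proof
    assume "\<Phi> = {}"
    then have "real n ^ v \<le> 0" using M by simp
    moreover have "real n ^ v > 0" using n by (intro zero_less_power) simp
    ultimately show False by linarith
  qed
  have inj: "inj_on \<phi> W" if "\<phi> \<in> \<Phi>" for \<phi> using that by (simp add: \<Phi>_def)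
  have EW: "E \<subseteq> Pow W" using E by (auto simp: all_edges_def)
  have injE: "inj_on (\<lambda>e. \<phi> ` e) E" if "\<phi> \<in> \<Phi>" for \<phi>
    using inj_on_subset[OF inj_on_image_Pow[OF inj[OF that]] EW] .
  have T: "T \<phi> \<subseteq> all_edges {..<n}" "card (T \<phi>) = card E" if "\<phi> \<in> \<Phi>" for \<phi>
  proof -
    show "card (T \<phi>) = card E" using injE[OF that] by (simp add: T_def card_image)
    have "card (\<phi> ` e) = card e" if "e \<in> E" for e
      using inj[OF \<open>\<phi> \<in> \<Phi>\<close>] EW that by (meson PowD card_image inj_on_subset subsetD)
    then show "T \<phi> \<subseteq> all_edges {..<n}"
      using that E by (fastforce simp: T_def all_edges_def \<Phi>_def)
  qed
  have corr: "(\<Sum>\<psi>\<in>\<Phi>. (1 / p) ^ card (T \<phi> \<inter> T \<psi>)) \<le> (1 + K / c) * card \<Phi>" if \<phi>: "\<phi> \<in> \<Phi>" for \<phi>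
  proof -
    \<comment> \<open>These are the edges of \<open>E\<close> whose \<open>\<phi>\<close>-image is
      also used by \<open>\<psi>\<close>; distinct edges have distinct images, so
      \<open>card (J \<psi>)\<close> is the size of the overlap.\<close>
    define J where "J \<psi> = {e \<in> E. \<phi> ` e \<in> T \<psi>}" for \<psi>
    have cJ: "card (T \<phi> \<inter> T \<psi>) = card (J \<psi>)" for \<psi>
    proof -
      have "T \<phi> \<inter> T \<psi> = (\<lambda>e. \<phi> ` e) ` J \<psi>" by (auto simp: T_def J_def)
      moreover have "inj_on (\<lambda>e. \<phi> ` e) (J \<psi>)"
        using injE[OF \<phi>] by (rule inj_on_subset) (auto simp: J_def)
      ultimately show ?thesis by (simp add: card_image)
    qed
    have bound: "(\<Sum>\<psi>\<in>{\<psi>\<in>\<Phi>. J \<psi> = Q}. (1 / p) ^ card Q) \<le> v ^ v * real n ^ v / c"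
      if Q: "Q \<subseteq> E" "Q \<noteq> {}" for Q
    proof -
      have U: "\<Union>Q \<subseteq> W" using Q EW by blast
      have cU: "card (\<Union>Q) \<le> v" using U W by (simp add: v_def card_mono)
      have "{\<psi>\<in>\<Phi>. J \<psi> = Q} \<subseteq> {\<psi> \<in> W \<rightarrow>\<^sub>E {..<n}. \<phi> ` \<Union>Q \<subseteq> \<psi> ` W}"
      proof clarify
        fix \<psi> assume \<psi>: "\<psi> \<in> \<Phi>" "Q = J \<psi>"
        have "\<phi> ` e \<subseteq> \<psi> ` W" if e: "e \<in> J \<psi>" for e
        proof -
          obtain e' where "e' \<in> E" "\<phi> ` e = \<psi> ` e'" using e by (auto simp: J_def T_def)
          then show ?thesis using EW by (auto intro!: image_mono)
        qed
        then show "\<psi> \<in> W \<rightarrow>\<^sub>E {..<n} \<and> \<phi> ` \<Union> (J \<psi>) \<subseteq> \<psi> ` W"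
          using \<psi> by (auto simp: \<Phi>_def)
      qed
      then have "card {\<psi>\<in>\<Phi>. J \<psi> = Q} \<le> card {\<psi> \<in> W \<rightarrow>\<^sub>E {..<n}. \<phi> ` \<Union>Q \<subseteq> \<psi> ` W}"
        by (intro card_mono finite_subset[OF _ finite_PiE[of W "\<lambda>_. {..<n}"]]) (use W in auto)
      also have "\<dots> \<le> v ^ v * n ^ (v - card (\<Union>Q))"
        unfolding v_def using U inj[OF \<phi>] W by (intro card_maps_covering) (auto intro: inj_on_subset)
      finally have "real (card {\<psi>\<in>\<Phi>. J \<psi> = Q}) \<le> real (v ^ v * n ^ (v - card (\<Union>Q)))"
        by (simp only: of_nat_le_iff)
      then have N: "real (card {\<psi>\<in>\<Phi>. J \<psi> = Q}) \<le> v ^ v * real n ^ (v - card (\<Union>Q))"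
        by simp
      have "finite Q" using Q finE finite_subset by blast
      then have "card Q \<ge> 1" using Q by (simp add: Suc_le_eq card_gt_0_iff)
      \<comment> \<open>Only one factor \<open>c\<close> is kept; it suffices to make the total
        error small.\<close>
      then have cQ: "c \<le> c ^ card Q" using c by (simp add: self_le_power)
      have "(1 / p) ^ card Q = (real n powr \<alpha>) ^ card Q / c ^ card Q"
        using n by (simp add: p(1) powr_minus field_simps power_divide power_mult_distrib)
      also have "(real n powr \<alpha>) ^ card Q = real n powr (\<alpha> * card Q)"
        using n by (simp add: powr_realpow[symmetric] powr_powr)
      also have "real n powr (\<alpha> * card Q) / c ^ card Q \<le> real n ^ card (\<Union>Q) / c"
      proof (intro frac_le)
        \<comment> \<open>Sparsity enters here: the gain from the shared edges is paid for by the
          vertices they fix.\<close>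
        have "real n powr (\<alpha> * card Q) \<le> real n powr real (card (\<Union>Q))"
          using n sparse[OF Q(1)] by (intro powr_mono) auto
        then show "real n powr (\<alpha> * card Q) \<le> real n ^ card (\<Union>Q)"
          using n by (simp add: powr_realpow)
      qed (use c cQ in auto)
      finally have P: "(1 / p) ^ card Q \<le> real n ^ card (\<Union>Q) / c" .
      have "(\<Sum>\<psi>\<in>{\<psi>\<in>\<Phi>. J \<psi> = Q}. (1 / p) ^ card Q)
          \<le> (v ^ v * real n ^ (v - card (\<Union>Q))) * (real n ^ card (\<Union>Q) / c)"
        unfolding sum_constant using N P p0 by (intro mult_mono) auto
      also have "\<dots> = v ^ v * (real n ^ (v - card (\<Union>Q)) * real n ^ card (\<Union>Q)) / c" by simp
      also have "real n ^ (v - card (\<Union>Q)) * real n ^ card (\<Union>Q) = real n ^ v"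
        using cU by (simp flip: power_add)
      finally show ?thesis by simp
    qed
    have "(\<Sum>\<psi>\<in>\<Phi>. (1 / p) ^ card (T \<phi> \<inter> T \<psi>)) = (\<Sum>\<psi>\<in>\<Phi>. (1 / p) ^ card (J \<psi>))"
      by (simp add: cJ)
    also have "\<dots> = (\<Sum>Q\<in>Pow E. \<Sum>\<psi>\<in>{\<psi>\<in>\<Phi>. J \<psi> = Q}. (1 / p) ^ card (J \<psi>))"
      using finE fin\<Phi> by (intro sum.group[symmetric]) (auto simp: J_def)
    also have "\<dots> = (\<Sum>Q\<in>Pow E. \<Sum>\<psi>\<in>{\<psi>\<in>\<Phi>. J \<psi> = Q}. (1 / p) ^ card Q)"
      by (intro sum.cong) auto
    \<comment> \<open>The class without shared edges gives the main term, at most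
      \<open>card \<Phi>\<close>; the rest is error.\<close>
    also have "\<dots> = card {\<psi>\<in>\<Phi>. J \<psi> = {}} + (\<Sum>Q\<in>Pow E - {{}}. \<Sum>\<psi>\<in>{\<psi>\<in>\<Phi>. J \<psi> = Q}. (1 / p) ^ card Q)"
      using finE by (subst sum.remove[of _ "{}"]) auto
    also have "\<dots> \<le> card \<Phi> + (\<Sum>Q\<in>Pow E - {{}}. v ^ v * real n ^ v / c)"
      using bound fin\<Phi> by (intro add_mono sum_mono) (auto intro: card_mono)
    also have "(\<Sum>Q\<in>Pow E - {{}}. v ^ v * real n ^ v / c) \<le> 2 ^ card E * (v ^ v * real n ^ v / c)"
    proof -
      have "card (Pow E - {{}}) \<le> 2 ^ card E"
        using card_Diff1_le[of "Pow E" "{}"] finE by (simp add: card_Pow)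
      then have "real (card (Pow E - {{}})) \<le> real (2 ^ card E)"
        by (simp only: of_nat_le_iff)
      then have "real (card (Pow E - {{}})) \<le> 2 ^ card E" by simp
      then show ?thesis using c unfolding sum_constant by (intro mult_right_mono) auto
    qed
    \<comment> \<open>By \<open>M\<close>, the power of \<open>n\<close> becomes a multiple of
      \<open>card \<Phi>\<close>, so that the error is relative to the main term.\<close>
    also have "\<dots> \<le> 2 ^ card E * (v ^ v * (2 ^ v * card \<Phi>) / c)"
    proof -
      have "real v ^ v * real n ^ v \<le> real v ^ v * (2 ^ v * card \<Phi>)"
        by (intro mult_left_mono M) simp
      then show ?thesis using c by (auto intro!: mult_left_mono divide_right_mono)
    qed
    also have "\<dots> = K / c * card \<Phi>"
      by (simp add: K_def v_def power_mult_distrib)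
    finally show ?thesis by (simp add: algebra_simps)
  qed
  have "measure_pmf.prob (bernoulli_edges (all_edges {..<n}) p)
      {b. \<not> (\<exists>\<phi>. \<phi> \<in> W \<rightarrow> {..<n} \<and> inj_on \<phi> W \<and> (\<forall>e\<in>E. b (\<phi> ` e)))}
    \<le> measure_pmf.prob (bernoulli_edges (all_edges {..<n}) p) {b. \<forall>\<phi>\<in>\<Phi>. \<exists>e\<in>T \<phi>. \<not> b e}"
  proof (intro measure_pmf.finite_measure_mono subsetI; clarify?)
    fix b \<phi>
    assume no: "\<nexists>\<phi>. \<phi> \<in> W \<rightarrow> {..<n} \<and> inj_on \<phi> W \<and> (\<forall>e\<in>E. b (\<phi> ` e))" and \<phi>: "\<phi> \<in> \<Phi>"
    then have "\<phi> \<in> W \<rightarrow> {..<n}" "inj_on \<phi> W" by (auto simp: \<Phi>_def)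
    with no show "\<exists>e\<in>T \<phi>. \<not> b e" by (auto simp: T_def)
  qed auto
  also have "\<dots> \<le> K / c"
    by (rule second_moment_bound[of _ _ _ "card E"])
      (use finA fin\<Phi> \<open>\<Phi> \<noteq> {}\<close> T p p0 corr in auto)
  finally show ?thesis by (simp add: K_def)
qed

section \<open>Density bounds from weight splittings\<close>

section \<open>The gadget\<close>

text \<open>A dual certificate for density: each arc splits weight \<alpha> between its ends and no
  vertex receives more than 1, so the edges of \<open>J\<close> carry total weight at most the
  number of vertices they touch.\<close>

lemma sparse_if_fractional_orientation:
  fixes R :: "('b \<times> 'b) set" and share :: "'b \<Rightarrow> 'b \<Rightarrow> real"
  assumes fin: "finite R" and \<alpha>: "\<alpha> \<ge> 0"
    and share: "\<And>x y. (x, y) \<in> R \<Longrightarrow> 0 \<le> share x y \<and> share x y \<le> \<alpha>"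
    and load: "\<And>v. (\<Sum>y | (v, y) \<in> R. share v y) + (\<Sum>x | (x, v) \<in> R. \<alpha> - share x v) \<le> 1"
    and J: "J \<subseteq> (\<lambda>(x, y). {x, y}) ` R"
  shows "\<alpha> * card J \<le> card (\<Union>J)"
proof -
  define K where "K = {(x, y) \<in> R. {x, y} \<in> J}"
  have finK: "finite K" using fin by (rule finite_subset[rotated]) (auto simp: K_def)
  have J_eq: "J = (\<lambda>(x, y). {x, y}) ` K" using J by (auto simp: K_def)
  have finU: "finite (\<Union>J)" using finK by (auto simp: J_eq)
  have finout: "finite {y. (v, y) \<in> R}" for v
    using fin by (rule finite_surj[where f = snd]) force
  have finin: "finite {x. (x, v) \<in> R}" for v
    using fin by (rule finite_surj[where f = fst]) force
  have out: "(\<Sum>(x, y)\<in>K. share x y) \<le> (\<Sum>v\<in>\<Union>J. \<Sum>y | (v, y) \<in> R. share v y)"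
  proof -
    \<comment> \<open>Shares are nonnegative, so the sum may be extended to all arcs leaving
      vertices of \<open>\<Union>J\<close>.\<close>
    have "(\<Sum>(x, y)\<in>K. share x y) \<le> (\<Sum>(x, y)\<in>(SIGMA v:\<Union>J. {y. (v, y) \<in> R}). share x y)"
      using finU finout share by (intro sum_mono2) (auto simp: K_def)
    then show ?thesis using finU finout by (simp add: sum.Sigma)
  qed
  have inn: "(\<Sum>(x, y)\<in>K. \<alpha> - share x y) \<le> (\<Sum>v\<in>\<Union>J. \<Sum>x | (x, v) \<in> R. \<alpha> - share x v)"
  proof -
    have "(\<Sum>(x, y)\<in>K. \<alpha> - share x y) = (\<Sum>(y, x)\<in>prod.swap ` K. \<alpha> - share x y)"
      by (subst sum.reindex) (auto simp: inj_on_def case_prod_unfold)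
    also have "\<dots> \<le> (\<Sum>(y, x)\<in>(SIGMA v:\<Union>J. {x. (x, v) \<in> R}). \<alpha> - share x y)"
      using finU finin share by (intro sum_mono2) (auto simp: K_def)
    also have "\<dots> = (\<Sum>v\<in>\<Union>J. \<Sum>x | (x, v) \<in> R. \<alpha> - share x v)"
      using finU finin by (simp add: sum.Sigma)
    finally show ?thesis .
  qed
  \<comment> \<open>Opposite arcs would give the same edge, hence an inequality.\<close>
  have "\<alpha> * card J \<le> \<alpha> * card K"
    using card_image_le[OF finK, of "\<lambda>(x, y). {x, y}"] \<alpha> by (auto simp: J_eq intro: mult_left_mono)
  also have "\<dots> = (\<Sum>(x, y)\<in>K. share x y) + (\<Sum>(x, y)\<in>K. \<alpha> - share x y)"
    by (simp add: case_prod_unfold flip: sum.distrib)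
  also have "\<dots> \<le> (\<Sum>v\<in>\<Union>J. (\<Sum>y | (v, y) \<in> R. share v y) + (\<Sum>x | (x, v) \<in> R. \<alpha> - share x v))"
    using out inn by (simp add: sum.distrib)
  also have "\<dots> \<le> (\<Sum>v\<in>\<Union>J. 1)" using load by (intro sum_mono)
  finally show ?thesis by simp
qed

section \<open>Vertices, arcs and weights of the gadget\<close>

datatype gadget_vertex =
  Core nat | Link nat nat | Rim nat | Rim_Link nat nat | Ext nat | Ext_Link nat nat | Tri nat

text \<open>The links \<open>Link l j\<close>, \<open>Rim_Link l j\<close>,
  \<open>Ext_Link l j\<close> have degree 2 and tie \<open>Core l\<close>, \<open>Rim l\<close>,
  \<open>Ext l\<close> to the hubs \<open>Core 0\<close>, \<open>Rim 0\<close>,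
  \<open>Core 0\<close>. Only \<open>Core 0\<close> is joined directly to the rim and only
  \<open>Rim 0\<close> to the extra cores; the process creates the other joins. \<open>Tri\<close>
  spans a separate triangle. Directions serve to tell the two ends of an edge apart when its weight
  is split.\<close>

fun arc :: "nat \<Rightarrow> nat \<Rightarrow> gadget_vertex \<Rightarrow> gadget_vertex \<Rightarrow> bool" where
  "arc k q (Core i) (Link l j) \<longleftrightarrow> l \<in> {1..<k} \<and> j < k + q \<and> (i = 0 \<or> i = l)"
| "arc k q (Core i) (Rim l) \<longleftrightarrow> i = 0 \<and> l \<le> k"
| "arc k q (Rim i) (Rim_Link l j) \<longleftrightarrow> l \<in> {1..k} \<and> j < q \<and> (i = 0 \<or> i = l)"
| "arc k q (Rim i) (Ext l) \<longleftrightarrow> i = 0 \<and> l < q"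
| "arc k q (Ext i) (Ext_Link l j) \<longleftrightarrow> i = l \<and> l < q \<and> j < q - 1"
| "arc k q (Core i) (Ext_Link l j) \<longleftrightarrow> i = 0 \<and> l < q \<and> j < q - 1"
| "arc k q (Tri i) (Tri j) \<longleftrightarrow> i < 3 \<and> j = (i + 1) mod 3"
| "arc k q _ _ \<longleftrightarrow> False"

(* The part of the weight \<alpha> of an arc that goes to its source; the rest goes to its target.  With
   \<delta> = 2 \<alpha> - 1, a vertex of degree 2 keeps weight 1 and passes \<delta> on to its two neighbours; these
   shares fill the core and rim vertices other than Rim 0 exactly to capacity 1. *)
fun gadget_share :: "nat \<Rightarrow> nat \<Rightarrow> real \<Rightarrow> real \<Rightarrow> gadget_vertex \<Rightarrow> gadget_vertex \<Rightarrow> real" where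
  "gadget_share k q \<alpha> \<delta> (Core i) (Link l j) =
     (if i = 0 then \<delta> - 1 / (k + q) else 1 / (k + q))"
| "gadget_share k q \<alpha> \<delta> (Core i) (Rim l) =
     (if l = 0 then 1 - (real k - 1) * ((real k + real q) * \<delta> - 1) else 0)"
| "gadget_share k q \<alpha> \<delta> (Rim i) (Rim_Link l j) =
     (if i = 0 then \<delta> - (1 - \<alpha>) / q else (1 - \<alpha>) / q)"
| "gadget_share k q \<alpha> \<delta> (Ext i) (Ext_Link l j) = \<delta>"
| "gadget_share k q \<alpha> \<delta> _ _ = 0"

definition gadget_verts :: "nat \<Rightarrow> nat \<Rightarrow> gadget_vertex set" where
  "gadget_verts k q = Core ` {..<k} \<union> case_prod Link ` ({1..<k} \<times> {..<k + q}) \<union> Rim ` {..k}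
     \<union> case_prod Rim_Link ` ({1..k} \<times> {..<q}) \<union> Ext ` {..<q}
     \<union> case_prod Ext_Link ` ({..<q} \<times> {..<q - 1}) \<union> Tri ` {..<3}"

definition gadget_edges :: "nat \<Rightarrow> nat \<Rightarrow> gadget_vertex set set" where
  "gadget_edges k q = (\<lambda>(x, y). {x, y}) ` {(x, y). arc k q x y}"

lemma finite_gadget_verts: "finite (gadget_verts k q)"
  by (simp add: gadget_verts_def)

lemma arc_verts: "arc k q x y \<Longrightarrow> k \<ge> 1 \<Longrightarrow> x \<in> gadget_verts k q \<and> y \<in> gadget_verts k q"
  by (cases "(k, q, x, y)" rule: arc.cases) (auto simp: gadget_verts_def image_iff)

lemma gadget_edges_subset: "k \<ge> 1 \<Longrightarrow> gadget_edges k q \<subseteq> all_edges (gadget_verts k q)"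
proof
  fix e assume "e \<in> gadget_edges k q" and k: "k \<ge> 1"
  then obtain x y where e: "e = {x, y}" "arc k q x y" by (auto simp: gadget_edges_def)
  then have "x \<noteq> y" by (cases "(k, q, x, y)" rule: arc.cases) (auto simp: mod_Suc)
  then show "e \<in> all_edges (gadget_verts k q)"
    using e arc_verts[OF e(2) k] by (simp add: all_edges_def)
qed

text \<open>The hypotheses are what \<open>gadget_share\<close> needs. \<open>core\<close> says that
  the capacity of \<open>Core 0\<close> left over by its links is a legal share for the edge to
  \<open>Rim 0\<close>; the first part of \<open>rim\<close> is the sign of the share of
  \<open>Rim 0\<close> in its links, the second its load; \<open>ext\<close> is the load of
  \<open>Ext l\<close>.\<close>

lemma gadget_sparse:
  fixes \<alpha> \<delta> :: real
  assumes kq: "k \<ge> 2" "q \<ge> 1" and \<alpha>: "\<alpha> = (1 + \<delta>) / 2" and \<delta>: "\<delta> \<le> 1" "(real k + real q) * \<delta> \<ge> 1"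
    and core: "0 \<le> 1 - (real k - 1) * ((real k + real q) * \<delta> - 1)" "1 - (real k - 1) * ((real k + real q) * \<delta> - 1) \<le> \<alpha>"
    and rim: "1 - \<alpha> \<le> q * \<delta>"
      "\<alpha> - (1 - (real k - 1) * ((real k + real q) * \<delta> - 1)) + k * (q * \<delta> - (1 - \<alpha>)) \<le> 1"
    and ext: "\<alpha> + (real q - 1) * \<delta> \<le> 1"
    and J: "J \<subseteq> gadget_edges k q"
  shows "\<alpha> * card J \<le> card (\<Union>J)"
proof (rule sparse_if_fractional_orientation[OF _ _ _ _ J[unfolded gadget_edges_def]])
  let ?R = "{(x, y). arc k q x y}"
  let ?s = "gadget_share k q \<alpha> \<delta>"
  have \<delta>0: "\<delta> \<ge> 1 / (k + q)" using \<delta> kq by (simp add: field_simps)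
  then have "\<delta> > 0" using kq by (smt (verit) divide_pos_pos of_nat_0_less_iff add_pos_pos less_le_trans zero_less_one one_le_numeral)
  then show \<alpha>0: "\<alpha> \<ge> 0" using \<alpha> by simp
  have \<delta>\<alpha>: "\<delta> \<le> \<alpha>" "\<alpha> \<le> 1" using \<delta> \<alpha> by auto
  have rq: "(1 - \<alpha>) / q \<le> \<delta>" "0 \<le> (1 - \<alpha>) / q" using rim(1) kq \<delta>\<alpha> by (auto simp: field_simps)
  show "finite ?R"
    by (rule finite_subset[of _ "gadget_verts k q \<times> gadget_verts k q"])
      (use arc_verts kq finite_gadget_verts in auto)
  show "0 \<le> ?s x y \<and> ?s x y \<le> \<alpha>" if "(x, y) \<in> ?R" for x y
  proof -
    have sh: "\<delta> - 1 / (k + q) \<le> \<alpha>" "\<delta> - (1 - \<alpha>) / q \<le> \<alpha>" "1 / (k + q) \<le> \<alpha>" "(1 - \<alpha>) / q \<le> \<alpha>"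
      using \<delta>\<alpha> \<delta>0 rq kq by (auto intro: order_trans[of _ \<delta>] simp: diff_le_eq add_increasing2)
    then show ?thesis using that \<delta>0 \<delta>\<alpha> \<alpha>0 \<open>\<delta> > 0\<close> core rq
      by (cases "(k, q, x, y)" rule: arc.cases) (auto simp: sh)
  qed
  have no_out: "{y. arc k q x y} = {}"
    if "case x of Link _ _ \<Rightarrow> True | Rim_Link _ _ \<Rightarrow> True | Ext_Link _ _ \<Rightarrow> True | _ \<Rightarrow> False" for x
    using that by (cases x) auto
  have no_in: "{x. arc k q x (Core i)} = {}" for i
    by (auto elim: arc.elims)
  show "(\<Sum>y | (v, y) \<in> ?R. ?s v y) + (\<Sum>x | (x, v) \<in> ?R. \<alpha> - ?s x v) \<le> 1" for v
  proof (cases v)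
    case (Core i)
    show ?thesis
    proof (cases "i = 0")
      case True
      \<comment> \<open>The edge to \<open>Rim 0\<close> takes exactly what the links leave, and all
        other edges give nothing to \<open>Core 0\<close>, so its load is 1.\<close>
      have "{y. arc k q (Core 0) y} = case_prod Link ` ({1..<k} \<times> {..<k + q}) \<union> (Rim ` {..k}
          \<union> case_prod Ext_Link ` ({..<q} \<times> {..<q - 1}))" (is "_ = ?L \<union> (?R1 \<union> ?X)")
        by (auto elim: arc.elims simp: image_iff)
      moreover have "sum (?s (Core 0)) (?L \<union> (?R1 \<union> ?X)) = sum (?s (Core 0)) ?L + (sum (?s (Core 0)) ?R1 + sum (?s (Core 0)) ?X)"
        by (subst sum.union_disjoint; (subst sum.union_disjoint)?) auto
      moreover have "sum (?s (Core 0)) ?L = (real k - 1) * ((real k + real q) * (\<delta> - 1 / (k + q)))"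
      proof -
        have "sum (?s (Core 0)) ?L = (\<Sum>x\<in>{1..<k} \<times> {..<k + q}. \<delta> - 1 / (k + q))"
          by (subst sum.reindex) (auto simp: inj_on_def case_prod_unfold simp del: sum_constant intro!: sum.cong)
        also have "\<dots> = real (k - 1) * (real (k + q) * (\<delta> - 1 / (k + q)))"
          unfolding sum_constant card_cartesian_product by (simp only: card_atLeastLessThan card_lessThan of_nat_mult mult.assoc)
        finally show ?thesis using kq by (simp only: of_nat_diff of_nat_add of_nat_1)
      qed
      moreover have "sum (?s (Core 0)) ?R1 = 1 - (real k - 1) * ((real k + real q) * \<delta> - 1)"
      proof -
        have "sum (?s (Core 0)) ?R1 = (\<Sum>l\<le>k. ?s (Core 0) (Rim l))"
          by (subst sum.reindex) (simp_all add: inj_on_def)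
        also have "\<dots> = (\<Sum>l\<in>{0}. ?s (Core 0) (Rim l))"
          by (rule sum.mono_neutral_right) auto
        finally show ?thesis by simp
      qed
      moreover have "sum (?s (Core 0)) ?X = 0"
        by (subst sum.reindex) (auto simp: inj_on_def case_prod_unfold)
      moreover have "(k + q) * (\<delta> - 1 / (k + q)) = (k + q) * \<delta> - 1"
        using kq by (simp add: field_simps)
      ultimately have "(\<Sum>y | arc k q (Core 0) y. ?s (Core 0) y) = 1" by simp
      then show ?thesis using True Core no_in by simp
    next
      case False
      have "{y. arc k q (Core i) y} = (if i < k then Link i ` {..<k + q} else {})"
        using False by (auto elim: arc.elims simp: image_iff)
      moreover have "sum (?s (Core i)) (Link i ` {..<k + q}) = 1"
        using False kq by (subst sum.reindex) (auto simp: inj_on_def)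
      ultimately show ?thesis using Core no_in by simp
    qed
  next
    \<comment> \<open>The two sources together keep \<delta>, so 2 \<alpha> - \<delta> = 1 arrives
      here; the same count settles \<open>Rim_Link\<close> and \<open>Ext_Link\<close>.\<close>
    case (Link l j)
    have "{x. arc k q x (Link l j)} = (if l \<in> {1..<k} \<and> j < k + q then {Core 0, Core l} else {})"
      by (auto elim: arc.elims)
    then show ?thesis using Link no_out[of v] \<alpha> by simp
  next
    case (Rim i)
    have i: "{x. arc k q x (Rim i)} = (if i \<le> k then {Core 0} else {})"
      by (auto elim: arc.elims)
    show ?thesis
    proof (cases "i = 0")
      case True
      have "{y. arc k q (Rim 0) y} = case_prod Rim_Link ` ({1..k} \<times> {..<q}) \<union> Ext ` {..<q}" (is "_ = ?L \<union> ?X")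
        by (auto elim: arc.elims simp: image_iff)
      moreover have "sum (?s (Rim 0)) (?L \<union> ?X) = sum (?s (Rim 0)) ?L + sum (?s (Rim 0)) ?X"
        by (subst sum.union_disjoint) auto
      moreover have "sum (?s (Rim 0)) ?L = k * (q * (\<delta> - (1 - \<alpha>) / q))"
      proof -
        have "sum (?s (Rim 0)) ?L = (\<Sum>x\<in>{1..k} \<times> {..<q}. \<delta> - (1 - \<alpha>) / q)"
          by (subst sum.reindex) (auto simp: inj_on_def case_prod_unfold simp del: sum_constant intro!: sum.cong)
        then show ?thesis by simp
      qed
      moreover have "sum (?s (Rim 0)) ?X = 0"
        by (subst sum.reindex) (auto simp: inj_on_def)
      moreover have "q * (\<delta> - (1 - \<alpha>) / q) = q * \<delta> - (1 - \<alpha>)"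
        using kq by (simp add: field_simps)
      ultimately have "(\<Sum>y | arc k q (Rim 0) y. ?s (Rim 0) y) = k * (q * \<delta> - (1 - \<alpha>))" by simp
      then show ?thesis using True Rim i rim(2) by simp
    next
      case False
      have "{y. arc k q (Rim i) y} = (if i \<le> k then Rim_Link i ` {..<q} else {})"
        using False by (auto elim: arc.elims simp: image_iff)
      moreover have "sum (?s (Rim i)) (Rim_Link i ` {..<q}) = 1 - \<alpha>"
        using False kq by (subst sum.reindex) (auto simp: inj_on_def)
      ultimately show ?thesis using Rim False i by simp
    qed
  next
    case (Rim_Link l j)
    have "{x. arc k q x (Rim_Link l j)} = (if l \<in> {1..k} \<and> j < q then {Rim 0, Rim l} else {})"
      by (auto elim: arc.elims)
    then show ?thesis using Rim_Link no_out[of v] \<alpha> by simp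
  next
    case (Ext l)
    have "{x. arc k q x (Ext l)} = (if l < q then {Rim 0} else {})"
      by (auto elim: arc.elims)
    moreover have "{y. arc k q (Ext l) y} = (if l < q then Ext_Link l ` {..<q - 1} else {})"
      by (auto elim: arc.elims simp: image_iff)
    moreover have "sum (?s (Ext l)) (Ext_Link l ` {..<q - 1}) = (real q - 1) * \<delta>"
      using kq by (subst sum.reindex) (auto simp: inj_on_def of_nat_diff)
    ultimately show ?thesis using Ext ext kq by (simp add: of_nat_diff)
  next
    case (Ext_Link l j)
    have "{x. arc k q x (Ext_Link l j)} = (if l < q \<and> j < q - 1 then {Ext l, Core 0} else {})"
      by (auto elim: arc.elims)
    then show ?thesis using Ext_Link no_out[of v] \<alpha> by simp
  next
    case (Tri i)
    \<comment> \<open>Only an inclusion, since for \<open>i \<ge> 3\<close> there is no incoming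
      arc.\<close>
    have "{x. arc k q x (Tri i)} \<subseteq> {Tri ((i + 2) mod 3)}"
    proof
      fix x assume "x \<in> {x. arc k q x (Tri i)}"
      then obtain j where "x = Tri j" "j < 3" "i = (j + 1) mod 3" by (cases x) auto
      then have "j = (i + 2) mod 3" by presburger
      then show "x \<in> {Tri ((i + 2) mod 3)}" using \<open>x = Tri j\<close> by simp
    qed
    then have "(\<Sum>x | arc k q x (Tri i). \<alpha> - ?s x (Tri i)) \<le> (\<Sum>x\<in>{Tri ((i + 2) mod 3)}. \<alpha> - ?s x (Tri i))"
      using \<alpha>0 by (intro sum_mono2) auto
    moreover have "(\<Sum>y | arc k q (Tri i) y. ?s (Tri i) y) = 0"
    proof (intro sum.neutral ballI)
      show "?s (Tri i) y = 0" for y by (cases y) simp_all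
    qed
    ultimately show ?thesis using Tri \<delta>\<alpha> by simp
  qed
qed

section \<open>Arithmetic of the weights for even and odd t\<close>

lemma gadget_parameters_even:
  fixes k q :: nat and \<alpha> \<delta> :: real
  assumes k: "k \<ge> 2"
  defines "\<alpha> \<equiv> 1 / eta (2 * k)"
  defines "\<delta> \<equiv> 2 * \<alpha> - 1" and "q \<equiv> k - 1"
  shows "\<delta> \<le> 1" "(real k + real q) * \<delta> \<ge> 1"
    "0 \<le> 1 - (real k - 1) * ((real k + real q) * \<delta> - 1)" "1 - (real k - 1) * ((real k + real q) * \<delta> - 1) \<le> \<alpha>"
    "1 - \<alpha> \<le> q * \<delta>"
    "\<alpha> - (1 - (real k - 1) * ((real k + real q) * \<delta> - 1)) + k * (q * \<delta> - (1 - \<alpha>)) \<le> 1"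
    "\<alpha> + (real q - 1) * \<delta> \<le> 1"
proof -
  define x where "x = real k"
  \<comment> \<open>The denominator of \<open>1 / eta (2 * k)\<close> after cancelling 4; it is
    common to all quantities below, which leaves polynomial inequalities in
    \<open>x\<close>.\<close>
  define N where "N = 6 * x * x - 7 * x + 3"
  have x: "x \<ge> 2" using k by (simp add: x_def)
  have xx: "x * x \<ge> 2 * x" using x by simp
  have N: "N > 0" using x xx unfolding N_def by linarith
  have q: "real q = x - 1" using k by (simp add: q_def x_def of_nat_diff)
  have \<alpha>: "\<alpha> = (3 * x * x - 2 * x + 2) / N"
  proof -
    have "\<alpha> = (4 * (3 * x * x - 2 * x + 2)) / (4 * N)"
      by (simp add: \<alpha>_def eta_def N_def x_def power2_eq_square algebra_simps)
    then show ?thesis by (simp only: mult_divide_mult_cancel_left)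
  qed
  have \<delta>: "\<delta> = (3 * x + 1) / N"
    using N unfolding \<delta>_def \<alpha> by (simp add: divide_simps) (simp add: N_def algebra_simps)
  have h: "(real k + q) * \<delta> - 1 = (6 * x - 4) / N"
    using N unfolding \<delta> q x_def[symmetric] by (simp add: divide_simps) (simp add: N_def algebra_simps)
  have y: "1 - (real k - 1) * ((real k + q) * \<delta> - 1) = (3 * x - 1) / N"
    using N unfolding h unfolding x_def[symmetric] by (simp add: divide_simps) (simp add: N_def algebra_simps)
  have D: "q * \<delta> - (1 - \<alpha>) = (3 * x - 2) / N"
    using N unfolding \<delta> \<alpha> q by (simp add: divide_simps) (simp add: N_def algebra_simps)
  have "3 * x + 1 \<le> N" unfolding N_def using x xx by linarith
  then show "\<delta> \<le> 1" using N unfolding \<delta> by simp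
  have "(real k + q) * \<delta> - 1 \<ge> 0" unfolding h using N x by simp
  then show "(real k + real q) * \<delta> \<ge> 1" by simp
  show "0 \<le> 1 - (real k - 1) * ((real k + real q) * \<delta> - 1)" unfolding y using N x by simp
  show "1 - (real k - 1) * ((real k + real q) * \<delta> - 1) \<le> \<alpha>"
  proof -
    have "3 * x - 1 \<le> 3 * x * x - 2 * x + 2" using x xx by linarith
    then show ?thesis unfolding y \<alpha> using N by (intro divide_right_mono) auto
  qed
  have "q * \<delta> - (1 - \<alpha>) \<ge> 0" unfolding D using N x by simp
  then show "1 - \<alpha> \<le> q * \<delta>" by simp
  \<comment> \<open>Equality holds: the load of \<open>Rim 0\<close> is exactly 1. It grows with
    \<alpha>, so this is the constraint that fixes the exponent for even t.\<close>
  show "\<alpha> - (1 - (real k - 1) * ((real k + real q) * \<delta> - 1)) + k * (q * \<delta> - (1 - \<alpha>)) \<le> 1"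
    unfolding y D unfolding \<alpha> x_def[symmetric] using N
    by (simp add: divide_simps) (simp add: N_def algebra_simps)
  show "\<alpha> + (real q - 1) * \<delta> \<le> 1"
    unfolding \<delta> \<alpha> q using N by (simp add: divide_simps) (simp add: N_def algebra_simps)
qed

text \<open>Here the binding constraint is at \<open>Core 0\<close>: its links alone use up its
  capacity, so the share for the edge to \<open>Rim 0\<close> is 0 and would become negative for a
  larger \<alpha>. \<open>Rim 0\<close> has room to spare.\<close>

lemma gadget_parameters_odd:
  fixes k q :: nat and \<alpha> \<delta> :: real
  assumes k: "k \<ge> 3"
  defines "\<alpha> \<equiv> 1 / eta (2 * k - 1)"
  defines "\<delta> \<equiv> 2 * \<alpha> - 1" and "q \<equiv> k - 2"
  shows "\<delta> \<le> 1" "(real k + real q) * \<delta> \<ge> 1"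
    "0 \<le> 1 - (real k - 1) * ((real k + real q) * \<delta> - 1)" "1 - (real k - 1) * ((real k + real q) * \<delta> - 1) \<le> \<alpha>"
    "1 - \<alpha> \<le> q * \<delta>"
    "\<alpha> - (1 - (real k - 1) * ((real k + real q) * \<delta> - 1)) + k * (q * \<delta> - (1 - \<alpha>)) \<le> 1"
    "\<alpha> + (real q - 1) * \<delta> \<le> 1"
proof -
  define z where "z = real k - 1"
  have z: "z \<ge> 2" "real k = z + 1" using k by (auto simp: z_def)
  have zz: "z * z \<ge> 2 * z" using z by simp
  have N: "z * z > 0" using z by simp
  have q: "real q = z - 1" using k by (simp add: q_def z_def of_nat_diff)
  have t: "real (2 * k - 1) = 2 * z + 1" using k by (simp add: z_def of_nat_diff)
  have odd: "odd (2 * k - 1)" using k by simp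
  have \<alpha>: "\<alpha> = (2 * z * z + z + 1) / (4 * (z * z))"
  proof -
    have "\<alpha> = (2 * (2 * z * z + z + 1)) / (2 * (4 * (z * z)))"
      unfolding \<alpha>_def eta_def t using odd by (simp add: power2_eq_square algebra_simps)
    then show ?thesis by (simp only: mult_divide_mult_cancel_left)
  qed
  have \<delta>: "\<delta> = (z + 1) / (2 * (z * z))"
    using z(1) unfolding \<delta>_def \<alpha> by (simp add: field_simps)
  have h: "(real k + q) * \<delta> - 1 = 1 / z"
    using z(1) unfolding \<delta> q z(2) by (simp add: field_simps)
  have y: "1 - (real k - 1) * ((real k + q) * \<delta> - 1) = 0"
    using z(1) unfolding h unfolding z(2) by simp
  have D: "q * \<delta> - (1 - \<alpha>) = (z - 1) / (4 * (z * z))"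
    using z(1) unfolding \<delta> \<alpha> q by (simp add: field_simps)
  have "z + 1 \<le> 2 * (z * z)" using z(1) zz by linarith
  then show "\<delta> \<le> 1" using N unfolding \<delta> by simp
  have "(real k + q) * \<delta> - 1 \<ge> 0" unfolding h using z(1) by simp
  then show "(real k + real q) * \<delta> \<ge> 1" by simp
  show "0 \<le> 1 - (real k - 1) * ((real k + real q) * \<delta> - 1)" unfolding y by simp
  show "1 - (real k - 1) * ((real k + real q) * \<delta> - 1) \<le> \<alpha>"
    unfolding y \<alpha> using z(1) by simp
  have "q * \<delta> - (1 - \<alpha>) \<ge> 0" unfolding D using z(1) by simp
  then show "1 - \<alpha> \<le> q * \<delta>" by simp
  show "\<alpha> - (1 - (real k - 1) * ((real k + real q) * \<delta> - 1)) + k * (q * \<delta> - (1 - \<alpha>)) \<le> 1"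
    unfolding y D unfolding \<alpha> z(2) using z(1) zz
    by (simp add: divide_simps) (simp add: algebra_simps)
  show "\<alpha> + (real q - 1) * \<delta> \<le> 1"
    unfolding \<delta> \<alpha> q using N z(1) by (simp add: divide_simps) (simp add: algebra_simps)
qed

text \<open>Even t takes k = t / 2 and q = k - 1, odd t takes k = (t + 1) / 2 and q = k - 2;
  \<open>t \<ge> 4\<close> ensures q \<ge> 1 in both cases.\<close>

lemma gadget_exists:
  fixes t :: nat
  assumes t: "t \<ge> 4"
  obtains k q where "k \<ge> 2" "q \<ge> 1" "t = k + q + 1"
    "\<And>J. J \<subseteq> gadget_edges k q \<Longrightarrow> 1 / eta t * card J \<le> card (\<Union>J)"
proof (cases "even t")
  case True
  then obtain k where k: "t = 2 * k" by blast
  then have k2: "k \<ge> 2" using t by simp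
  show ?thesis
  proof (rule that[of k "k - 1"])
    show "1 / eta t * card J \<le> card (\<Union>J)" if "J \<subseteq> gadget_edges k (k - 1)" for J
      unfolding k
      by (rule gadget_sparse[OF k2 _ _ gadget_parameters_even[OF k2] that]) (use k2 in simp_all)
  qed (use k k2 in simp_all)
next
  case False
  then obtain k' where k': "t = 2 * k' + 1" by (rule oddE)
  define k where "k = k' + 1"
  have k: "t = 2 * k - 1" "k \<ge> 3" using t k' by (auto simp: k_def)
  have k2: "k \<ge> 2" using k by simp
  show ?thesis
  proof (rule that[of k "k - 2"])
    show "1 / eta t * card J \<le> card (\<Union>J)" if "J \<subseteq> gadget_edges k (k - 2)" for J
      unfolding k(1)
      by (rule gadget_sparse[OF k2 _ _ gadget_parameters_odd[OF k(2)] that]) (use k in simp_all)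
  qed (use k in simp_all)
qed

text \<open>Injectivity preserves the number of common neighbours. It lets the closure of the gadget
  be computed in the gadget's own vertices; membership in \<open>W\<close> is part of the relation
  to secure \<open>adj_verts\<close>.\<close>

lemma (in twin_closed_graph) twin_closed_graph_pullback:
  assumes inj: "inj_on \<phi> W" and t: "t \<ge> 2"
  shows "twin_closed_graph t W (\<lambda>x y. x \<in> W \<and> y \<in> W \<and> adj (\<phi> x) (\<phi> y))"
proof
  fix S u w v
  assume S: "finite S" "t \<le> card S + 1"
      "\<And>x. x \<in> S \<Longrightarrow> (u \<in> W \<and> x \<in> W \<and> adj (\<phi> u) (\<phi> x)) \<and> w \<in> W \<and> x \<in> W \<and> adj (\<phi> w) (\<phi> x)"
    and uw: "u \<noteq> w" and wv: "w \<in> W \<and> v \<in> W \<and> adj (\<phi> w) (\<phi> v)" and vu: "v \<noteq> u"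
  have "S \<noteq> {}" using S(2) t by auto
  then have u: "u \<in> W" using S(3) by blast
  have "S \<subseteq> W" using S(3) by blast
  then have "card (\<phi> ` S) = card S" using inj by (metis card_image inj_on_subset)
  then have "adj (\<phi> u) (\<phi> v)"
    using twin[of "\<phi> ` S" "\<phi> u" "\<phi> w" "\<phi> v"] S u uw wv vu inj by (auto simp: inj_on_eq_iff)
  then show "u \<in> W \<and> v \<in> W \<and> adj (\<phi> u) (\<phi> v)" using u wv by blast
qed (use adj_sym adj_irrefl in auto)

section \<open>A complete bipartite graph in the closure of the gadget\<close>

definition gadget_left :: "nat \<Rightarrow> nat \<Rightarrow> gadget_vertex set" where
  "gadget_left k q = Core ` {..<k} \<union> Ext ` {..<q} \<union> {Rim_Link 1 0}"

text \<open>With \<open>gadget_left\<close>, the two sides of the K_{t,t} found in the closure. The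
  k + q cores and extra cores on one side and the k + q links of \<open>Core 1\<close> on the other
  are each one short of t; \<open>Rim_Link 1 0\<close> and \<open>Rim 0\<close> fill the
  gaps.\<close>

definition gadget_right :: "nat \<Rightarrow> nat \<Rightarrow> gadget_vertex set" where
  "gadget_right k q = Link 1 ` {..<k + q} \<union> {Rim 0}"

lemma card_gadget_left: "card (gadget_left k q) = k + q + 1"
proof -
  have "card (Core ` {..<k} \<union> Ext ` {..<q}) = k + q"
    by (subst card_Un_disjoint) (auto simp: card_image inj_on_def)
  moreover have "Rim_Link 1 0 \<notin> Core ` {..<k} \<union> Ext ` {..<q}" by auto
  ultimately show ?thesis by (simp add: gadget_left_def)
qed

lemma card_gadget_right: "card (gadget_right k q) = k + q + 1"
proof -
  have "Rim 0 \<notin> Link 1 ` {..<k + q}" by auto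
  then show ?thesis by (simp add: gadget_right_def card_image inj_on_def)
qed

text \<open>Each round of twins supplies the common neighbours of the next: private links for the
  cores, cores for the rim, rim for the extra cores. With links added, the count is always k + q = t
  - 1.\<close>

lemma gadget_closure:
  assumes "twin_closed_graph (k + q + 1) W adj" and kq: "k \<ge> 2" "q \<ge> 1"
    and arcs: "\<And>x y. arc k q x y \<Longrightarrow> adj x y"
    and x: "x \<in> gadget_left k q" and y: "y \<in> gadget_right k q"
  shows "adj x y"
proof -
  interpret twin_closed_graph "k + q + 1" W adj by fact
  have arcs': "adj y x" if "arc k q x y" for x y using arcs[OF that] adj_sym by blast
  have core_twin: "adj (Core i) v" if "i \<in> {1..<k}" "adj (Core 0) v" "v \<noteq> Core i" for i v
    by (rule twin[of "Link i ` {..<k + q}" _ "Core 0"])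
      (use that in \<open>auto intro!: arcs simp: card_image inj_on_def\<close>)
  have core_link: "adj (Core i) (Link 1 j)" if "i < k" "j < k + q" for i j
    using core_twin[of i "Link 1 j"] arcs[of "Core 0" "Link 1 j"] that kq by (cases "i = 0") auto
  have core_rim: "adj (Core i) (Rim l)" if "i < k" "l \<le> k" for i l
    using core_twin[of i "Rim l"] arcs[of "Core 0" "Rim l"] that by (cases "i = 0") auto
  have rim_twin: "adj (Rim i) v" if "i \<in> {1..k}" "adj (Rim 0) v" "v \<noteq> Rim i" for i v
  proof (rule twin[of "Core ` {..<k} \<union> Rim_Link i ` {..<q}" _ "Rim 0"])
    have "card (Core ` {..<k} \<union> Rim_Link i ` {..<q}) = k + q"
      by (subst card_Un_disjoint) (auto simp: card_image inj_on_def)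
    then show "k + q + 1 \<le> card (Core ` {..<k} \<union> Rim_Link i ` {..<q}) + 1" by simp
  qed (use that in \<open>auto intro: arcs adj_sym[OF core_rim]\<close>)
  have ext_rim: "adj (Rim i) (Ext l)" if "i \<le> k" "l < q" for i l
    using rim_twin[of i "Ext l"] arcs[of "Rim 0" "Ext l"] that by (cases "i = 0") auto
  have ext_twin: "adj (Ext l) v" if "l < q" "adj (Core 0) v" "v \<noteq> Ext l" for l v
  proof (rule twin[of "Rim ` {..k} \<union> Ext_Link l ` {..<q - 1}" _ "Core 0"])
    have "card (Rim ` {..k} \<union> Ext_Link l ` {..<q - 1}) = k + q"
      using kq by (subst card_Un_disjoint) (auto simp: card_image inj_on_def)
    then show "k + q + 1 \<le> card (Rim ` {..k} \<union> Ext_Link l ` {..<q - 1}) + 1" by simp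
  qed (use that kq in \<open>auto intro: arcs core_rim adj_sym[OF ext_rim]\<close>)
  have ext_link: "adj (Ext l) (Link 1 j)" if "l < q" "j < k + q" for l j
    using ext_twin[of l "Link 1 j"] arcs[of "Core 0" "Link 1 j"] that kq by auto
  \<comment> \<open>The roles are reversed: a link of \<open>Core 1\<close> shares all cores and
    extra cores with \<open>Rim 0\<close> and so inherits its neighbour
    \<open>Rim_Link 1 0\<close>.\<close>
  have link_rimlink: "adj (Link 1 j) (Rim_Link 1 0)" if "j < k + q" for j
  proof (rule twin[of "Core ` {..<k} \<union> Ext ` {..<q}" _ "Rim 0"])
    have "card (Core ` {..<k} \<union> Ext ` {..<q}) = k + q"
      by (subst card_Un_disjoint) (auto simp: card_image inj_on_def)
    then show "k + q + 1 \<le> card (Core ` {..<k} \<union> Ext ` {..<q}) + 1" by simp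
  qed (use that kq in \<open>auto intro: arcs ext_rim adj_sym[OF core_link] adj_sym[OF core_rim] adj_sym[OF ext_link]
      simp del: One_nat_def\<close>)
  show ?thesis
    using x y kq
    by (auto simp: gadget_left_def gadget_right_def simp del: One_nat_def
        intro: core_link core_rim ext_link adj_sym[OF ext_rim] adj_sym[OF link_rimlink] arcs')
qed

section \<open>Connectivity of the random graph and the critical probability\<close>

section \<open>Connectivity and the threshold\<close>

text \<open>The gadget provides the K_{t,t} and, through \<open>Tri\<close>, the odd cycle;
  connectivity, stated as an edge across every cut, spreads the twin classes over all of
  \<open>V\<close>.\<close>

lemma percolates_if_gadget_and_connected:
  assumes kq: "k \<ge> 2" "q \<ge> 1" and t: "t = k + q + 1" and E: "E \<subseteq> all_edges V"
    and inj: "inj_on \<phi> (gadget_verts k q)" and copy: "\<And>e. e \<in> gadget_edges k q \<Longrightarrow> \<phi> ` e \<in> E"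
    and conn: "\<And>S. S \<subseteq> V \<Longrightarrow> S \<noteq> {} \<Longrightarrow> S \<noteq> V \<Longrightarrow> \<exists>x\<in>S. \<exists>y\<in>V - S. {x, y} \<in> E"
  shows "percolates (complete_bipartite 2 t) (V, E)"
proof -
  define F where "F = edges (final_graph (complete_bipartite 2 t) (V, E))"
  let ?W = "gadget_verts k q"
  interpret twin_closed_graph t V "\<lambda>u v. {u, v} \<in> F"
    unfolding F_def using twin_closed_final_graph[OF E] kq t by simp
  have EF: "E \<subseteq> F"
  proof -
    have "E = edges (bootstrap (complete_bipartite 2 t) (V, E) 0)" by simp
    also have "\<dots> \<subseteq> F" unfolding F_def final_graph_def snd_conv by blast
    finally show ?thesis .
  qed
  have FV: "F \<subseteq> all_edges V"
    using edges_bootstrap_subset[of "(V, E)" "complete_bipartite 2 t"] E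
    by (fastforce simp: F_def final_graph_def)
  have arcs: "{\<phi> x, \<phi> y} \<in> F" if "arc k q x y" for x y
  proof -
    have "{x, y} \<in> gadget_edges k q" using that by (force simp: gadget_edges_def)
    from copy[OF this] show ?thesis using EF by auto
  qed
  have pull: "twin_closed_graph (k + q + 1) ?W (\<lambda>x y. x \<in> ?W \<and> y \<in> ?W \<and> {\<phi> x, \<phi> y} \<in> F)"
    using twin_closed_graph_pullback[OF inj] kq t by simp
  have LR: "x \<in> ?W \<and> y \<in> ?W \<and> {\<phi> x, \<phi> y} \<in> F" if "x \<in> gadget_left k q" "y \<in> gadget_right k q" for x y
    using gadget_closure[OF pull kq _ that] arcs arc_verts kq by (metis one_le_numeral order_trans)
  have sub: "gadget_left k q \<subseteq> ?W" "gadget_right k q \<subseteq> ?W"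
  proof -
    have "gadget_left k q \<noteq> {}" "gadget_right k q \<noteq> {}" by (auto simp: gadget_left_def gadget_right_def)
    then show "gadget_left k q \<subseteq> ?W" "gadget_right k q \<subseteq> ?W" using LR by blast+
  qed
  have disj: "gadget_left k q \<inter> gadget_right k q = {}" by (auto simp: gadget_left_def gadget_right_def)
  have tri: "{\<phi> (Tri 0), \<phi> (Tri 1)} \<in> F" "{\<phi> (Tri 1), \<phi> (Tri 2)} \<in> F" "{\<phi> (Tri 2), \<phi> (Tri 0)} \<in> F"
    by (rule arcs; simp)+
  have "{u, v} \<in> F" if "u \<in> V" "v \<in> V" "u \<noteq> v" for u v
  proof (rule complete_if_contains_complete_bipartite[of "\<phi> ` gadget_left k q" "\<phi> ` gadget_right k q", OF _ _ _ _ _ _ _ _ tri that])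
    show "2 \<le> t" using kq t by simp
    show "finite (\<phi> ` gadget_left k q)" "finite (\<phi> ` gadget_right k q)"
      by (simp_all add: gadget_left_def gadget_right_def)
    show "\<phi> ` gadget_left k q \<inter> \<phi> ` gadget_right k q = {}"
      using inj_on_image_Int[OF inj sub] disj by simp
    show "t \<le> card (\<phi> ` gadget_left k q)" "t \<le> card (\<phi> ` gadget_right k q)"
      using t by (simp_all add: card_image inj_on_subset[OF inj sub(1)] inj_on_subset[OF inj sub(2)]
          card_gadget_left card_gadget_right)
    show "{a, b} \<in> F" if "a \<in> \<phi> ` gadget_left k q" "b \<in> \<phi> ` gadget_right k q" for a b
      using that LR by blast
    show "\<exists>x\<in>S. \<exists>y\<in>V - S. {x, y} \<in> F" if "S \<subseteq> V" "S \<noteq> {}" "S \<noteq> V" for S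
      using conn[OF that] EF by blast
  qed
  then have "all_edges V \<subseteq> F"
    by (auto simp: all_edges_def card_2_iff)
  then show ?thesis
    using FV by (simp add: percolates_def is_complete_def F_def final_graph_def)
qed

lemma sum_power_card_Pow:
  fixes r :: real
  assumes "finite A"
  shows "(\<Sum>S\<in>Pow A. r ^ card S) = (1 + r) ^ card A"
  using prod_add[OF assms, of "\<lambda>_. r" "\<lambda>_. 1"] by (simp add: add.commute)

text \<open>A union bound over the empty cuts. A side \<open>S\<close> with at most n / 2 vertices
  faces at least \<open>n div 2\<close> others, which gives at most r ^ card S for r = (1 - p) ^ (n
  div 2).\<close>

lemma prob_disconnected_le:
  assumes p: "0 \<le> p" "p \<le> 1"
  shows "measure_pmf.prob (bernoulli_edges (all_edges {..<n}) p)
      {b. \<exists>S\<subseteq>{..<n}. S \<noteq> {} \<and> S \<noteq> {..<n} \<and> (\<forall>x\<in>S. \<forall>y\<in>{..<n} - S. \<not> b {x, y})}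
    \<le> (1 + (1 - p) ^ (n div 2)) ^ n - 1"
proof -
  let ?M = "bernoulli_edges (all_edges {..<n}) p"
  \<comment> \<open>It suffices to consider the smaller side of a cut.\<close>
  define Q where "Q = {S. S \<subseteq> {..<n} \<and> S \<noteq> {} \<and> 2 * card S \<le> n}"
  define T where "T S = (\<lambda>(x, y). {x, y}) ` (S \<times> ({..<n} - S))" for S :: "nat set"
  define B where "B S = {b. \<forall>e\<in>T S. \<not> b e}" for S
  have finA: "finite (all_edges {..<n})"
    by (rule finite_subset[of _ "Pow {..<n}"]) (auto simp: all_edges_def)
  have finQ: "finite Q" unfolding Q_def by (rule finite_subset[of _ "Pow {..<n}"]) auto
  have "{b. \<exists>S\<subseteq>{..<n}. S \<noteq> {} \<and> S \<noteq> {..<n} \<and> (\<forall>x\<in>S. \<forall>y\<in>{..<n} - S. \<not> b {x, y})} \<subseteq> (\<Union>S\<in>Q. B S)"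
  proof
    fix b
    assume "b \<in> {b. \<exists>S\<subseteq>{..<n}. S \<noteq> {} \<and> S \<noteq> {..<n} \<and> (\<forall>x\<in>S. \<forall>y\<in>{..<n} - S. \<not> b {x, y})}"
    then obtain S where S: "S \<subseteq> {..<n}" "S \<noteq> {}" "S \<noteq> {..<n}"
      and b: "\<forall>x\<in>S. \<forall>y\<in>{..<n} - S. \<not> b {x, y}" by blast
    have finS: "finite S" using S by (auto intro: finite_subset)
    show "b \<in> (\<Union>S\<in>Q. B S)"
    proof (cases "2 * card S \<le> n")
      case True
      then have "S \<in> Q" using S by (auto simp: Q_def)
      moreover have "b \<in> B S" using b by (auto simp: B_def T_def)
      ultimately show ?thesis by blast
    next
      case False
      have "card ({..<n} - S) = n - card S" using S finS by (simp add: card_Diff_subset)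
      then have "{..<n} - S \<in> Q" using S False by (auto simp: Q_def)
      moreover have "b \<in> B ({..<n} - S)"
        unfolding B_def T_def mem_Collect_eq
      proof (intro ballI notI)
        fix e assume e: "e \<in> (\<lambda>(x, y). {x, y}) ` (({..<n} - S) \<times> ({..<n} - ({..<n} - S)))" and "b e"
        from e obtain x y where "e = {y, x}" "x \<in> {..<n} - S" "y \<in> S" by auto
        with b \<open>b e\<close> show False by blast
      qed
      ultimately show ?thesis by blast
    qed
  qed
  then have "measure_pmf.prob ?M
      {b. \<exists>S\<subseteq>{..<n}. S \<noteq> {} \<and> S \<noteq> {..<n} \<and> (\<forall>x\<in>S. \<forall>y\<in>{..<n} - S. \<not> b {x, y})}
      \<le> measure_pmf.prob ?M (\<Union>S\<in>Q. B S)"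
    by (intro measure_pmf.finite_measure_mono) auto
  also have "\<dots> \<le> (\<Sum>S\<in>Q. measure_pmf.prob ?M (B S))"
    using finQ by (intro measure_pmf.finite_measure_subadditive_finite) auto
  also have "\<dots> \<le> (\<Sum>S\<in>Q. ((1 - p) ^ (n div 2)) ^ card S)"
  proof (rule sum_mono)
    fix S assume S: "S \<in> Q"
    then have finS: "finite S" by (auto simp: Q_def intro: finite_subset)
    have "card (T S) = card (S \<times> ({..<n} - S))"
      unfolding T_def by (intro card_image) (auto simp: inj_on_def doubleton_eq_iff)
    also have "\<dots> = card S * (n - card S)"
      using S finS by (simp add: Q_def card_cartesian_product card_Diff_subset)
    finally have cT: "card (T S) = card S * (n - card S)" .
    have "T S \<subseteq> all_edges {..<n}" using S by (auto simp: T_def all_edges_def Q_def card_2_iff doubleton_eq_iff)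
    then have "measure_pmf.prob ?M (B S) = (1 - p) ^ (card S * (n - card S))"
      using prob_none_present[OF finA _ p] cT by (simp add: B_def)
    also have "\<dots> \<le> (1 - p) ^ (n div 2 * card S)"
    proof (rule power_decreasing)
      have "n div 2 \<le> n - card S" using S by (auto simp: Q_def)
      then show "n div 2 * card S \<le> card S * (n - card S)" by (simp add: mult.commute)
    qed (use p in auto)
    finally show "measure_pmf.prob ?M (B S) \<le> ((1 - p) ^ (n div 2)) ^ card S"
      by (simp add: power_mult)
  qed
  \<comment> \<open>Admitting all nonempty sets gives a binomial sum in closed form.\<close>
  also have "\<dots> \<le> (\<Sum>S\<in>Pow {..<n} - {{}}. ((1 - p) ^ (n div 2)) ^ card S)"
    using p by (intro sum_mono2) (auto simp: Q_def)
  also have "\<dots> = (\<Sum>S\<in>Pow {..<n}. ((1 - p) ^ (n div 2)) ^ card S) - 1"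
    by (subst sum.remove[of "Pow {..<n}" "{}"]) auto
  also have "\<dots> = (1 + (1 - p) ^ (n div 2)) ^ n - 1"
    by (simp add: sum_power_card_Pow)
  finally show ?thesis .
qed

text \<open>Two uses of 1 + x \<le> exp x, and \<open>n div 2\<close> \<ge> (n - 1) / 2, bring the
  bound into a form without integer division whose limit can be computed automatically.\<close>

lemma disconnection_bound_le_exp:
  assumes p: "0 \<le> p" "p \<le> 1" and n: "n \<ge> 1"
  shows "(1 + (1 - p) ^ (n div 2)) ^ n - 1 \<le> exp (real n * exp (- (p * ((real n - 1) / 2)))) - 1"
proof -
  have "(1 - p) ^ (n div 2) \<le> exp (- p) ^ (n div 2)"
    using p exp_ge_add_one_self[of "- p"] by (intro power_mono) auto
  also have "\<dots> = exp (- (p * real (n div 2)))" by (simp add: exp_of_nat_mult[symmetric] mult.commute)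
  also have "\<dots> \<le> exp (- (p * ((real n - 1) / 2)))"
  proof -
    have "n \<le> 2 * (n div 2) + 1" by simp
    then have "real n \<le> real (2 * (n div 2) + 1)" by (simp only: of_nat_le_iff)
    then have "(real n - 1) / 2 \<le> real (n div 2)" by simp
    then have "p * ((real n - 1) / 2) \<le> p * real (n div 2)" using p by (intro mult_left_mono)
    then show ?thesis by simp
  qed
  finally have r: "(1 - p) ^ (n div 2) \<le> exp (- (p * ((real n - 1) / 2)))" .
  have "(1 + (1 - p) ^ (n div 2)) ^ n \<le> exp ((1 - p) ^ (n div 2)) ^ n"
    using p by (intro power_mono exp_ge_add_one_self) auto
  also have "\<dots> = exp (real n * (1 - p) ^ (n div 2))" by (simp add: exp_of_nat_mult)
  also have "\<dots> \<le> exp (real n * exp (- (p * ((real n - 1) / 2))))"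
    using r by (simp add: mult_left_mono)
  finally show ?thesis by simp
qed

text \<open>The witness \<open>p\<close> makes the set nonempty, so that its infimum is meaningful.
  The lower bound removes the norm in the final estimate.\<close>

lemma critical_prob_bounds:
  assumes "p \<in> {0..1}" "measure_pmf.prob (random_graph n p) {G. percolates H G} \<ge> 1 / 2"
  shows "0 \<le> critical_prob n H" "critical_prob n H \<le> p"
proof -
  let ?P = "{p \<in> {0..1}. measure_pmf.prob (random_graph n p) {G. percolates H G} \<ge> 1 / 2}"
  have "p \<in> ?P" using assms by blast
  then show "0 \<le> critical_prob n H" unfolding critical_prob_def
    by (intro cInf_greatest) auto
  show "critical_prob n H \<le> p" unfolding critical_prob_def
    using \<open>p \<in> ?P\<close> by (intro cInf_lower) (auto intro!: bdd_belowI[of _ 0])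
qed

text \<open>Ensures that the edge probability has order above 1 / n by a power of n, as connectivity
  requires.\<close>

lemma eta_gt_1:
  assumes "t \<ge> 4"
  shows "eta t > 1"
proof -
  define x where "x = real t"
  have x: "x \<ge> 4" using assms by (simp add: x_def)
  then have xx: "x * x \<ge> 4 * x" by simp
  have "3 * x ^ 2 - 4 * x + 8 > 0" "x ^ 2 - x + 2 > 0"
      "6 * x ^ 2 - 14 * x + 12 > 3 * x ^ 2 - 4 * x + 8" "2 * x ^ 2 - 4 * x + 2 > x ^ 2 - x + 2"
    using x xx unfolding power2_eq_square by linarith+
  then show ?thesis unfolding eta_def x_def[symmetric] by simp
qed

theorem theorem2p6:
  fixes t :: nat
  assumes "t \<ge> 4"
  shows "(\<lambda>n. critical_prob n (complete_bipartite 2 t)) \<in> O(\<lambda>n. real n powr (- (1 / eta t)))"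
proof -
  obtain k q where kq: "k \<ge> 2" "q \<ge> 1" and t: "t = k + q + 1"
    and sparse: "\<And>J. J \<subseteq> gadget_edges k q \<Longrightarrow> 1 / eta t * card J \<le> card (\<Union>J)"
    using gadget_exists[OF assms] by metis
  let ?W = "gadget_verts k q" and ?E = "gadget_edges k q" and ?H = "complete_bipartite 2 t"
  define \<alpha> where "\<alpha> = 1 / eta t"
  have \<alpha>: "0 < \<alpha>" "\<alpha> < 1" using eta_gt_1[OF assms] by (auto simp: \<alpha>_def)
  define K where "K = (2 ^ card ?E * (2 * card ?W) ^ card ?W :: real)"
  \<comment> \<open>Chosen so that the second moment error \<open>K / c\<close> is at most 1 /
    4.\<close>
  define c where "c = 4 * K + 1"
  have K: "K \<ge> 0" by (simp add: K_def)
  have c: "c \<ge> 1" "c > 0" using K by (auto simp: c_def)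
  define p where "p n = c * real n powr - \<alpha>" for n :: nat
  have "((\<lambda>n. p n) \<longlongrightarrow> 0) at_top" unfolding p_def using \<alpha> c by real_asymp
  then have ev1: "eventually (\<lambda>n. p n < 1) at_top" by (rule order_tendstoD) simp
  \<comment> \<open>As \<alpha> < 1, n * p n grows like a power of n, and the inner exponential
    beats the factor n.\<close>
  have "((\<lambda>n. exp (real n * exp (- (p n * ((real n - 1) / 2)))) - 1) \<longlongrightarrow> 0) at_top"
    unfolding p_def using \<alpha> c by real_asymp
  then have ev2: "eventually (\<lambda>n. exp (real n * exp (- (p n * ((real n - 1) / 2)))) - 1 < 1 / 4) at_top"
    by (rule order_tendstoD) simp
  have "eventually (\<lambda>n. norm (critical_prob n ?H) \<le> c * norm (real n powr - \<alpha>)) at_top"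
    using ev1 ev2 eventually_ge_at_top[of "2 * card ?W + 1"]
  proof eventually_elim
    case (elim n)
    have p: "0 \<le> p n" "p n \<le> 1" using elim c by (auto simp: p_def)
    let ?M = "bernoulli_edges (all_edges {..<n}) (p n)"
    let ?g = "\<lambda>b. ({..<n}, {e \<in> all_edges {..<n}. b e})"
    define B1 where "B1 = {b. \<not> (\<exists>\<phi>. \<phi> \<in> ?W \<rightarrow> {..<n} \<and> inj_on \<phi> ?W \<and> (\<forall>e\<in>?E. b (\<phi> ` e)))}"
    define B2 where "B2 = {b. \<exists>S\<subseteq>{..<n}. S \<noteq> {} \<and> S \<noteq> {..<n} \<and> (\<forall>x\<in>S. \<forall>y\<in>{..<n} - S. \<not> b {x, y})}"
    have EW: "?E \<subseteq> all_edges ?W" using kq by (intro gadget_edges_subset) simp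
    have "measure_pmf.prob ?M B1 \<le> K / c"
      unfolding B1_def K_def
      by (rule prob_no_copy_le[where \<alpha> = \<alpha>])
        (use finite_gadget_verts EW sparse elim c p in \<open>auto simp: \<alpha>_def p_def\<close>)
    also have "\<dots> \<le> 1 / 4" using K c by (simp add: c_def field_simps)
    finally have P1: "measure_pmf.prob ?M B1 \<le> 1 / 4" .
    have P2: "measure_pmf.prob ?M B2 \<le> 1 / 4"
      using prob_disconnected_le[OF p, of n] disconnection_bound_le_exp[OF p, of n] elim
      unfolding B2_def by simp
    have good: "percolates ?H (?g b)" if b: "b \<notin> B1" "b \<notin> B2" for b
    proof -
      obtain \<phi> where \<phi>: "\<phi> \<in> ?W \<rightarrow> {..<n}" "inj_on \<phi> ?W" "\<forall>e\<in>?E. b (\<phi> ` e)"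
        using b by (auto simp: B1_def)
      show ?thesis
      proof (rule percolates_if_gadget_and_connected[OF kq t _ \<phi>(2)])
        fix e assume e: "e \<in> ?E"
        then have e': "e \<subseteq> ?W" "card e = 2" using EW by (auto simp: all_edges_def)
        then have "card (\<phi> ` e) = 2" using \<phi>(2) by (metis card_image inj_on_subset)
        then show "\<phi> ` e \<in> {e \<in> all_edges {..<n}. b e}"
          using e e' \<phi> by (auto simp: all_edges_def)
      next
        fix S assume S: "S \<subseteq> {..<n}" "S \<noteq> {}" "S \<noteq> {..<n}"
        then obtain x y where xy: "x \<in> S" "y \<in> {..<n} - S" "b {x, y}"
          using b(2) unfolding B2_def by blast
        then have "x \<noteq> y" by blast
        then have "{x, y} \<in> all_edges {..<n}" using S xy by (auto simp: all_edges_def)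
        then show "\<exists>x\<in>S. \<exists>y\<in>{..<n} - S. {x, y} \<in> {e \<in> all_edges {..<n}. b e}"
          using xy by blast
      qed auto
    qed
    have "1 - measure_pmf.prob ?M (B1 \<union> B2) = measure_pmf.prob ?M (- (B1 \<union> B2))"
      using measure_pmf.prob_compl[of "B1 \<union> B2" ?M] by (simp add: Compl_eq_Diff_UNIV)
    also have "\<dots> \<le> measure_pmf.prob ?M (?g -` {G. percolates ?H G})"
      using good by (intro measure_pmf.finite_measure_mono) auto
    also have "\<dots> = measure_pmf.prob (random_graph n (p n)) {G. percolates ?H G}"
      by (simp add: random_graph_def)
    \<comment> \<open>Each of the two bad events has probability at most 1 / 4.\<close>
    finally have "measure_pmf.prob (random_graph n (p n)) {G. percolates ?H G} \<ge> 1 / 2"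
      using measure_Un_le[of B1 ?M B2] P1 P2 by simp
    then show "norm (critical_prob n ?H) \<le> c * norm (real n powr - \<alpha>)"
      using critical_prob_bounds[of "p n" n ?H] p by (simp add: p_def)
  qed
  then show ?thesis unfolding \<alpha>_def by (rule bigoI)
qed

end
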